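(* Let $M$ be a strictly pseudoconvex CR manifold, $\theta$ a contact form on $M$ with $G_\theta$ positive definite, and $y,z\in M$. Let $\gamma\in\Gamma$ and $X\in T_\gamma(\Gamma)$. Let $a=c_0<c_1<\cdots<c_h<c_{h+1}=b$ be a partition such that $\gamma$ is differentiable on each $[c_j,c_{j+1}]$, $0\le j\le h$. Let $r=|\dot\gamma(t)|>0$ be the common length of the tangent vectors along $\gamma$. Then $$(d_\gamma L)X=\frac1r\Big\{\sum_{j=1}^h g_{\theta,\gamma(c_j)}\big(X_{\gamma(c_j)},\dot\gamma(c_j^-)-\dot\gamma(c_j^+)\big)-\int_a^b\big[g_\theta(X,\nabla_{\dot\gamma}\dot\gamma)-g_\theta(T_\nabla(X,\dot\gamma),\dot\gamma)\big]_{\gamma(t)}\,dt\Big\},$$ where $\dot\gamma(c_j^\pm)=\lim_{t\to c_j^\pm}\dot\gamma(t)$, $\nabla$ is the Tanaka-Webster connection of $(M,\theta)$ and $T_\nabla$ its torsion.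
   Context: Setting. $M$ is an orientable $C^\infty$ manifold of dimension $2n+1$ with a CR structure $T_{1,0}(M)\subset T(M)\otimes\mathbb C$ (a complex subbundle of complex rank $n$, with $T_{1,0}(M)\cap\overline{T_{1,0}(M)}=(0)$, closed under Lie brackets). $H(M)=\mathrm{Re}\{T_{1,0}(M)\oplus\overline{T_{1,0}(M)}\}$ is the Levi distribution, with complex structure $J(Z+\overline Z)=i(Z-\overline Z)$, $Z\in T_{1,0}(M)$. $\theta$ is a nowhere zero real $1$-form with $\mathrm{Ker}(\theta)=H(M)$; convention: $d\theta(X,Y)=\frac12\{X(\theta(Y))-Y(\theta(X))-\theta([X,Y])\}$. $G_\theta(X,Y)=(d\theta)(X,JY)$ on $H(M)$, assumed positive definite (strict pseudoconvexity). $T$ is the vector field with $\theta(T)=1$, $T\rfloor d\theta=0$; set $JT=0$. The Webster metric is the Riemannian metric $g_\theta$ with $g_\theta=G_\theta$ on $H(M)$, $g_\theta(X,T)=0$ for $X\in H(M)$, $g_\theta(T,T)=1$. The Tanaka-Webster connection $\nabla$ is the unique linear connection such that $H(M)$ is parallel, $\nabla g_\theta=0$, $\nabla J=0$, and its torsion $T_\nabla$ satisfies $T_\nabla(Z,W)=0$, $T_\nabla(Z,\overline W)=2(d\theta)(Z,\overline W)T$ for $Z,W\in T_{1,0}(M)$, and $\tau\circ J+J\circ\tau=0$, where $\tau(X)=T_\nabla(T,X)$. $\Gamma$ is the set of all piecewise differentiable curves $\gamma:[a,b]\to M$ parametrized proportionally to arc length (w.r.t. $g_\theta$) with $\gamma(a)=y$,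 $\gamma(b)=z$. $T_\gamma(\Gamma)$ is the space of all piecewise differentiable vector fields $X$ along $\gamma$ vanishing at the endpoints $\gamma(a)$, $\gamma(b)$. For $X\in T_\gamma(\Gamma)$ one takes a family $\gamma^s:[a,b]\to M$, $|s|<\epsilon$, such that $\gamma^s\in\Gamma$, $\gamma^0=\gamma$, there is a partition $a=t_0<\cdots<t_k=b$ with $(t,s)\mapsto\gamma^s(t)$ differentiable on each $[t_j,t_{j+1}]\times(-\epsilon,\epsilon)$, and for each $t$ the curve $\sigma_t(s)=\gamma^s(t)$ satisfies $\dot\sigma_t(0)=X_{\gamma(t)}$; then $(d_\gamma L)X=\frac{d}{ds}\{L(\gamma^s)\}_{s=0}$, where $L(\gamma^s)$ is the Riemannian length of $\gamma^s$ with respect to $g_\theta$. *)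

theory Defs
  imports "HOL-Analysis.Analysis"
begin


section \<open>Smooth maps between normed spaces\<close>

text \<open>\<open>Ck_on\<close> is meant for open sets only. On an arbitrary set (closed intervals, strips),
  smooth means: restriction of a smooth map defined on an open superset.\<close>

primrec Ck_on :: "nat \<Rightarrow> 'a::real_normed_vector set \<Rightarrow> ('a \<Rightarrow> 'b::real_normed_vector) \<Rightarrow> bool" where
  "Ck_on 0 U f \<longleftrightarrow> continuous_on U f"
| "Ck_on (Suc k) U f \<longleftrightarrow>
     (\<forall>x\<in>U. f differentiable (at x)) \<and> (\<forall>v. Ck_on k U (\<lambda>x. frechet_derivative f (at x) v))"

definition smooth_on :: "'a::real_normed_vector set \<Rightarrow> ('a \<Rightarrow> 'b::real_normed_vector) \<Rightarrow> bool" where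
  "smooth_on S f \<longleftrightarrow>
     (\<exists>U F. open U \<and> S \<subseteq> U \<and> (\<forall>k. Ck_on k U F) \<and> (\<forall>x\<in>S. F x = f x))"

section \<open>Smooth manifolds\<close>

text \<open>A manifold is a type \<open>'m\<close> (Hausdorff and second countable in the theorem) with a smooth atlas
  modelled on \<open>real ^ 'k\<close>.\<close>

type_synonym ('m, 'k) chart = "'m set \<times> ('m \<Rightarrow> real ^ 'k)"

abbreviation cdom :: "('m, 'k) chart \<Rightarrow> 'm set" where
  "cdom \<equiv> fst"

abbreviation coord :: "('m, 'k) chart \<Rightarrow> 'm \<Rightarrow> real ^ 'k" where
  "coord \<equiv> snd"

definition param :: "('m, 'k) chart \<Rightarrow> real ^ 'k \<Rightarrow> 'm" where
  "param c = inv_into (cdom c) (coord c)"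

definition is_chart :: "('m::topological_space, 'k::finite) chart \<Rightarrow> bool" where
  "is_chart c \<longleftrightarrow> open (cdom c) \<and> open (coord c ` cdom c) \<and>
     homeomorphism (cdom c) (coord c ` cdom c) (coord c) (param c)"

definition smooth_atlas :: "('m::topological_space, 'k::finite) chart set \<Rightarrow> bool" where
  "smooth_atlas A \<longleftrightarrow> (\<forall>c\<in>A. is_chart c) \<and> (\<Union>c\<in>A. cdom c) = UNIV \<and>
     (\<forall>c\<in>A. \<forall>d\<in>A. smooth_on (coord c ` (cdom c \<inter> cdom d)) (coord d \<circ> param c))"

definition orientable :: "('m::topological_space, 'k::finite) chart set \<Rightarrow> bool" where
  "orientable A \<longleftrightarrow> (\<exists>B. smooth_atlas B \<and> smooth_atlas (A \<union> B) \<and>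
     (\<forall>c\<in>B. \<forall>d\<in>B. \<forall>x \<in> coord c ` (cdom c \<inter> cdom d).
        det (matrix (frechet_derivative (coord d \<circ> param c) (at x))) > 0))"

text \<open>Smooth functions on an open \<open>U\<close>, and smooth maps from a subset of a normed space (an interval,
  a strip) into the manifold.\<close>

definition smooth_fun ::
  "('m::topological_space, 'k::finite) chart set \<Rightarrow> 'm set \<Rightarrow> ('m \<Rightarrow> 'b::real_normed_vector) \<Rightarrow> bool" where
  "smooth_fun A U f \<longleftrightarrow> (\<forall>c\<in>A. smooth_on (coord c ` (cdom c \<inter> U)) (f \<circ> param c))"

definition smooth_map_into ::
  "('m::topological_space, 'k::finite) chart set \<Rightarrow> 'a::real_normed_vector set \<Rightarrow> ('a \<Rightarrow> 'm) \<Rightarrow> bool" where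
  "smooth_map_into A S f \<longleftrightarrow> (\<forall>x\<in>S. \<exists>c\<in>A. \<exists>V. open V \<and> x \<in> V \<and> f ` (V \<inter> S) \<subseteq> cdom c \<and>
     smooth_on (V \<inter> S) (coord c \<circ> f))"

section \<open>Tangent vectors and vector fields\<close>

text \<open>The tangent space at every point \<open>p\<close> is \<open>real ^ 'k\<close>: a tangent vector at \<open>p\<close> is represented by
  its components in one preferred chart \<open>chart_at A p\<close> around \<open>p\<close>, which is chosen once and for
  all. The choice is not continuous in \<open>p\<close>, so vectors at different points are never compared
  (differentiated, passed to a limit) directly, but only after their components have been moved to one
  common chart by \<open>components\<close>. A vector field is a function \<open>'m \<Rightarrow> real ^ 'k\<close>.\<close>

definition chart_at :: "('m, 'k) chart set \<Rightarrow> 'm \<Rightarrow> ('m, 'k) chart" where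
  "chart_at A p = (SOME c. c \<in> A \<and> p \<in> cdom c)"

text \<open>\<open>dir_deriv A p v f\<close> is \<open>v(f)\<close> for a tangent vector \<open>v\<close> at \<open>p\<close> and \<open>f\<close> smooth near \<open>p\<close>.\<close>

definition dir_deriv ::
  "('m, 'k::finite) chart set \<Rightarrow> 'm \<Rightarrow> real ^ 'k \<Rightarrow> ('m \<Rightarrow> 'b::real_normed_vector) \<Rightarrow> 'b" where
  "dir_deriv A p v f =
     frechet_derivative (f \<circ> param (chart_at A p)) (at (coord (chart_at A p) p)) v"

text \<open>Components in the chart \<open>c\<close> of a tangent vector at \<open>p\<close>; they are its derivatives of the
  coordinate functions.\<close>

definition components ::
  "('m, 'k::finite) chart set \<Rightarrow> ('m, 'k) chart \<Rightarrow> 'm \<Rightarrow> real ^ 'k \<Rightarrow> real ^ 'k" where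
  "components A c p v = dir_deriv A p v (coord c)"

definition smooth_vf ::
  "('m::topological_space, 'k::finite) chart set \<Rightarrow> 'm set \<Rightarrow> ('m \<Rightarrow> real ^ 'k) \<Rightarrow> bool" where
  "smooth_vf A U X \<longleftrightarrow> (\<forall>c\<in>A. smooth_fun A (cdom c \<inter> U) (\<lambda>p. components A c p (X p)))"

text \<open>In a chart, \<open>[X, Y]\<close> has the components \<open>X(Y\<^sup>i) - Y(X\<^sup>i)\<close>.\<close>

definition lie_bracket ::
  "('m, 'k::finite) chart set \<Rightarrow> ('m \<Rightarrow> real ^ 'k) \<Rightarrow> ('m \<Rightarrow> real ^ 'k) \<Rightarrow> 'm \<Rightarrow> real ^ 'k" where
  "lie_bracket A X Y p =
     dir_deriv A p (X p) (\<lambda>q. components A (chart_at A p) q (Y q)) -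
     dir_deriv A p (Y p) (\<lambda>q. components A (chart_at A p) q (X q))"

text \<open>\<open>const_ext A p v\<close> extends a tangent vector \<open>v\<close> at \<open>p\<close> to the vector field near \<open>p\<close> that has constant
  components in \<open>chart_at A p\<close>. It serves to evaluate at single tangent vectors those tensors that
  are given by a formula in vector fields; the value does not depend on the extension used.\<close>

definition const_ext ::
  "('m, 'k::finite) chart set \<Rightarrow> 'm \<Rightarrow> real ^ 'k \<Rightarrow> 'm \<Rightarrow> real ^ 'k" where
  "const_ext A p v q =
     frechet_derivative (coord (chart_at A q) \<circ> param (chart_at A p)) (at (coord (chart_at A p) q)) v"

definition one_form ::
  "('m::topological_space, 'k::finite) chart set \<Rightarrow> ('m \<Rightarrow> real ^ 'k \<Rightarrow> real) \<Rightarrow> bool" where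
  "one_form A \<theta> \<longleftrightarrow> (\<forall>p. linear (\<theta> p)) \<and>
     (\<forall>U X. open U \<and> smooth_vf A U X \<longrightarrow> smooth_fun A U (\<lambda>p. \<theta> p (X p)))"

text \<open>The convention with the factor 1/2.\<close>

definition ext_d ::
  "('m, 'k::finite) chart set \<Rightarrow> ('m \<Rightarrow> real ^ 'k \<Rightarrow> real) \<Rightarrow> 'm \<Rightarrow> real ^ 'k \<Rightarrow> real ^ 'k \<Rightarrow> real" where
  "ext_d A \<theta> p v w =
     (let X = const_ext A p v; Y = const_ext A p w in
      1/2 * (dir_deriv A p v (\<lambda>q. \<theta> q (Y q)) - dir_deriv A p w (\<lambda>q. \<theta> q (X q))
             - \<theta> p (lie_bracket A X Y p)))"

section \<open>CR structures\<close>

text \<open>The complexified tangent space at each point is \<open>complex ^ 'k\<close>.\<close>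

definition re_vec :: "complex ^ 'k \<Rightarrow> real ^ 'k" where
  "re_vec Z = (\<chi> i. Re (Z $ i))"

definition im_vec :: "complex ^ 'k \<Rightarrow> real ^ 'k" where
  "im_vec Z = (\<chi> i. Im (Z $ i))"

definition cvec :: "real ^ 'k \<Rightarrow> real ^ 'k \<Rightarrow> complex ^ 'k" where
  "cvec v w = (\<chi> i. Complex (v $ i) (w $ i))"

abbreviation of_real_vec :: "real ^ 'k \<Rightarrow> complex ^ 'k" where
  "of_real_vec v \<equiv> cvec v 0"

definition cnj_vec :: "complex ^ 'k \<Rightarrow> complex ^ 'k" where
  "cnj_vec Z = (\<chi> i. cnj (Z $ i))"

text \<open>Complex bilinear extensions of real bilinear maps.\<close>

definition cbilin :: "(real ^ 'k \<Rightarrow> real ^ 'k \<Rightarrow> real) \<Rightarrow> complex ^ 'k \<Rightarrow> complex ^ 'k \<Rightarrow> complex" where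
  "cbilin B Z W = Complex (B (re_vec Z) (re_vec W) - B (im_vec Z) (im_vec W))
                          (B (re_vec Z) (im_vec W) + B (im_vec Z) (re_vec W))"

definition cbilin_vec ::
  "(real ^ 'k \<Rightarrow> real ^ 'k \<Rightarrow> real ^ 'k) \<Rightarrow> complex ^ 'k \<Rightarrow> complex ^ 'k \<Rightarrow> complex ^ 'k" where
  "cbilin_vec B Z W = cvec (B (re_vec Z) (re_vec W) - B (im_vec Z) (im_vec W))
                           (B (re_vec Z) (im_vec W) + B (im_vec Z) (re_vec W))"

definition smooth_cvf ::
  "('m::topological_space, 'k::finite) chart set \<Rightarrow> 'm set \<Rightarrow> ('m \<Rightarrow> complex ^ 'k) \<Rightarrow> bool" where
  "smooth_cvf A U Z \<longleftrightarrow> smooth_vf A U (\<lambda>p. re_vec (Z p)) \<and> smooth_vf A U (\<lambda>p. im_vec (Z p))"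

definition clie_bracket ::
  "('m, 'k::finite) chart set \<Rightarrow> ('m \<Rightarrow> complex ^ 'k) \<Rightarrow> ('m \<Rightarrow> complex ^ 'k) \<Rightarrow> 'm \<Rightarrow> complex ^ 'k" where
  "clie_bracket A Z W p =
     (let X = (\<lambda>q. re_vec (Z q)); Y = (\<lambda>q. im_vec (Z q));
          X' = (\<lambda>q. re_vec (W q)); Y' = (\<lambda>q. im_vec (W q))
      in cvec (lie_bracket A X X' p - lie_bracket A Y Y' p)
              (lie_bracket A X Y' p + lie_bracket A Y X' p))"

definition cr_structure ::
  "('m::topological_space, 'k::finite) chart set \<Rightarrow> nat \<Rightarrow> ('m \<Rightarrow> (complex ^ 'k) set) \<Rightarrow> bool" where
  "cr_structure A n T10 \<longleftrightarrow>
     (\<forall>p. vec.subspace (T10 p) \<and> vec.dim (T10 p) = n) \<and>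
     (\<forall>p. \<exists>U (Z :: nat \<Rightarrow> 'm \<Rightarrow> complex ^ 'k). open U \<and> p \<in> U \<and> (\<forall>i<n. smooth_cvf A U (Z i)) \<and>
        (\<forall>q\<in>U. T10 q = vec.span ((\<lambda>i. Z i q) ` {..<n}))) \<and>
     (\<forall>p. T10 p \<inter> cnj_vec ` T10 p = {0}) \<and>
     (\<forall>U Z W. open U \<and> smooth_cvf A U Z \<and> smooth_cvf A U W \<and> (\<forall>q\<in>U. Z q \<in> T10 q \<and> W q \<in> T10 q)
        \<longrightarrow> (\<forall>q\<in>U. clie_bracket A Z W q \<in> T10 q))"

text \<open>The Levi distribution: the real vectors in \<open>T10 \<oplus> cnj T10\<close>.\<close>

definition levi :: "('m \<Rightarrow> (complex ^ 'k) set) \<Rightarrow> 'm \<Rightarrow> (real ^ 'k) set" where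
  "levi T10 p = {v. \<exists>Z\<in>T10 p. \<exists>W\<in>T10 p. of_real_vec v = Z + cnj_vec W}"

definition contact_form ::
  "('m::topological_space, 'k::finite) chart set \<Rightarrow> ('m \<Rightarrow> (complex ^ 'k) set) \<Rightarrow>
   ('m \<Rightarrow> real ^ 'k \<Rightarrow> real) \<Rightarrow> bool" where
  "contact_form A T10 \<theta> \<longleftrightarrow> one_form A \<theta> \<and>
     (\<forall>p. (\<exists>v. \<theta> p v \<noteq> 0) \<and> {v. \<theta> p v = 0} = levi T10 p)"

definition characteristic_field ::
  "('m::topological_space, 'k::finite) chart set \<Rightarrow> ('m \<Rightarrow> real ^ 'k \<Rightarrow> real) \<Rightarrow> ('m \<Rightarrow> real ^ 'k) \<Rightarrow> bool" where
  "characteristic_field A \<theta> T \<longleftrightarrow> smooth_vf A UNIV T \<and>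
     (\<forall>p. \<theta> p (T p) = 1 \<and> (\<forall>v. ext_d A \<theta> p (T p) v = 0))"

text \<open>The complex structure \<open>J (Z + cnj Z) = \<i> (Z - cnj Z)\<close> on the Levi distribution, extended by
  \<open>J T = 0\<close>.\<close>

definition cr_complex_structure ::
  "('m \<Rightarrow> (complex ^ 'k::finite) set) \<Rightarrow> ('m \<Rightarrow> real ^ 'k) \<Rightarrow> ('m \<Rightarrow> real ^ 'k \<Rightarrow> real ^ 'k) \<Rightarrow> bool" where
  "cr_complex_structure T10 T J \<longleftrightarrow>
     (\<forall>p. linear (J p) \<and> J p (T p) = 0 \<and>
        (\<forall>v. \<forall>Z\<in>T10 p. of_real_vec v = Z + cnj_vec Z \<longrightarrow>
           of_real_vec (J p v) = \<i> *s (Z - cnj_vec Z)))"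

definition G_form ::
  "('m, 'k::finite) chart set \<Rightarrow> ('m \<Rightarrow> real ^ 'k \<Rightarrow> real) \<Rightarrow> ('m \<Rightarrow> real ^ 'k \<Rightarrow> real ^ 'k) \<Rightarrow>
   'm \<Rightarrow> real ^ 'k \<Rightarrow> real ^ 'k \<Rightarrow> real" where
  "G_form A \<theta> J p v w = ext_d A \<theta> p v (J p w)"

definition positive_definite_on :: "'v::real_vector set \<Rightarrow> ('v \<Rightarrow> 'v \<Rightarrow> real) \<Rightarrow> bool" where
  "positive_definite_on H B \<longleftrightarrow> (\<forall>v\<in>H. v \<noteq> 0 \<longrightarrow> B v v > 0)"

definition riemannian_metric ::
  "('m::topological_space, 'k::finite) chart set \<Rightarrow> ('m \<Rightarrow> real ^ 'k \<Rightarrow> real ^ 'k \<Rightarrow> real) \<Rightarrow> bool" where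
  "riemannian_metric A g \<longleftrightarrow>
     (\<forall>p. bilinear (g p) \<and> (\<forall>v w. g p v w = g p w v) \<and> positive_definite_on UNIV (g p)) \<and>
     (\<forall>U X Y. open U \<and> smooth_vf A U X \<and> smooth_vf A U Y \<longrightarrow> smooth_fun A U (\<lambda>p. g p (X p) (Y p)))"

definition webster_metric ::
  "('m::topological_space, 'k::finite) chart set \<Rightarrow> ('m \<Rightarrow> (complex ^ 'k) set) \<Rightarrow>
   ('m \<Rightarrow> real ^ 'k \<Rightarrow> real) \<Rightarrow> ('m \<Rightarrow> real ^ 'k) \<Rightarrow> ('m \<Rightarrow> real ^ 'k \<Rightarrow> real ^ 'k) \<Rightarrow>
   ('m \<Rightarrow> real ^ 'k \<Rightarrow> real ^ 'k \<Rightarrow> real) \<Rightarrow> bool" where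
  "webster_metric A T10 \<theta> T J g \<longleftrightarrow> riemannian_metric A g \<and>
     (\<forall>p. (\<forall>v\<in>levi T10 p. \<forall>w\<in>levi T10 p. g p v w = G_form A \<theta> J p v w) \<and>
          (\<forall>v\<in>levi T10 p. g p v (T p) = 0) \<and> g p (T p) (T p) = 1)"

section \<open>Linear connections and the Tanaka-Webster connection\<close>

text \<open>\<open>N p v Y\<close> is the covariant derivative at \<open>p\<close> of \<open>Y\<close> in direction \<open>v\<close>. The axioms are imposed for
  all vector fields that are smooth on some open set around \<open>p\<close>, not only for global ones; this makes
  the dependence on \<open>Y\<close> local, as one sees by taking for \<open>f\<close> the indicator of a neighbourhood of \<open>p\<close>.\<close>

type_synonym ('m, 'k) connection = "'m \<Rightarrow> real ^ 'k \<Rightarrow> ('m \<Rightarrow> real ^ 'k) \<Rightarrow> real ^ 'k"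

definition linear_connection ::
  "('m::topological_space, 'k::finite) chart set \<Rightarrow> ('m, 'k) connection \<Rightarrow> bool" where
  "linear_connection A N \<longleftrightarrow>
     (\<forall>U X Y. open U \<and> smooth_vf A U X \<and> smooth_vf A U Y \<longrightarrow> smooth_vf A U (\<lambda>p. N p (X p) Y)) \<and>
     (\<forall>U Y. open U \<and> smooth_vf A U Y \<longrightarrow> (\<forall>p\<in>U. linear (\<lambda>v. N p v Y))) \<and>
     (\<forall>U Y Z. open U \<and> smooth_vf A U Y \<and> smooth_vf A U Z \<longrightarrow>
        (\<forall>p\<in>U. \<forall>v. N p v (\<lambda>q. Y q + Z q) = N p v Y + N p v Z)) \<and>
     (\<forall>U (f :: 'm \<Rightarrow> real) Y. open U \<and> smooth_fun A U f \<and> smooth_vf A U Y \<longrightarrow>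
        (\<forall>p\<in>U. \<forall>v. N p v (\<lambda>q. f q *\<^sub>R Y q) = dir_deriv A p v f *\<^sub>R Y p + f p *\<^sub>R N p v Y))"

definition torsion ::
  "('m, 'k::finite) chart set \<Rightarrow> ('m, 'k) connection \<Rightarrow> 'm \<Rightarrow> real ^ 'k \<Rightarrow> real ^ 'k \<Rightarrow> real ^ 'k" where
  "torsion A N p v w =
     (let X = const_ext A p v; Y = const_ext A p w in N p v Y - N p w X - lie_bracket A X Y p)"

definition tanaka_webster ::
  "('m::topological_space, 'k::finite) chart set \<Rightarrow> ('m \<Rightarrow> (complex ^ 'k) set) \<Rightarrow>
   ('m \<Rightarrow> real ^ 'k \<Rightarrow> real) \<Rightarrow> ('m \<Rightarrow> real ^ 'k) \<Rightarrow> ('m \<Rightarrow> real ^ 'k \<Rightarrow> real ^ 'k) \<Rightarrow>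
   ('m \<Rightarrow> real ^ 'k \<Rightarrow> real ^ 'k \<Rightarrow> real) \<Rightarrow> ('m, 'k) connection \<Rightarrow> bool" where
  "tanaka_webster A T10 \<theta> T J g N \<longleftrightarrow> linear_connection A N \<and>
     \<comment> \<open>\<open>H(M)\<close> is parallel\<close>
     (\<forall>U Y. open U \<and> smooth_vf A U Y \<and> (\<forall>q\<in>U. Y q \<in> levi T10 q) \<longrightarrow>
        (\<forall>p\<in>U. \<forall>v. N p v Y \<in> levi T10 p)) \<and>
     \<comment> \<open>\<open>g\<close> is parallel\<close>
     (\<forall>U Y Z. open U \<and> smooth_vf A U Y \<and> smooth_vf A U Z \<longrightarrow>
        (\<forall>p\<in>U. \<forall>v. dir_deriv A p v (\<lambda>q. g q (Y q) (Z q)) = g p (N p v Y) (Z p) + g p (Y p) (N p v Z))) \<and>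
     \<comment> \<open>\<open>J\<close> is parallel\<close>
     (\<forall>U Y. open U \<and> smooth_vf A U Y \<longrightarrow>
        (\<forall>p\<in>U. \<forall>v. N p v (\<lambda>q. J q (Y q)) = J p (N p v Y))) \<and>
     \<comment> \<open>the torsion is pure\<close>
     (\<forall>p. \<forall>Z\<in>T10 p. \<forall>W\<in>T10 p. cbilin_vec (torsion A N p) Z W = 0 \<and>
        cbilin_vec (torsion A N p) Z (cnj_vec W) =
          (2 * cbilin (ext_d A \<theta> p) Z (cnj_vec W)) *s of_real_vec (T p)) \<and>
     (\<forall>p v. torsion A N p (T p) (J p v) + J p (torsion A N p (T p) v) = 0)"

section \<open>Curves\<close>

definition velocity ::
  "('m, 'k::finite) chart set \<Rightarrow> (real \<Rightarrow> 'm) \<Rightarrow> real \<Rightarrow> real ^ 'k" where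
  "velocity A \<gamma> t = vector_derivative (coord (chart_at A (\<gamma> t)) \<circ> \<gamma>) (at t)"

text \<open>One-sided limits of the velocity, taken in the tangent bundle: near the point \<open>\<gamma> t\<close> this
  means convergence of the components in the chart \<open>chart_at A (\<gamma> t)\<close>.\<close>

definition velocity_left ::
  "('m, 'k::finite) chart set \<Rightarrow> (real \<Rightarrow> 'm) \<Rightarrow> real \<Rightarrow> real ^ 'k" where
  "velocity_left A \<gamma> t = Lim (at_left t) (\<lambda>u. components A (chart_at A (\<gamma> t)) (\<gamma> u) (velocity A \<gamma> u))"

definition velocity_right ::
  "('m, 'k::finite) chart set \<Rightarrow> (real \<Rightarrow> 'm) \<Rightarrow> real \<Rightarrow> real ^ 'k" where
  "velocity_right A \<gamma> t = Lim (at_right t) (\<lambda>u. components A (chart_at A (\<gamma> t)) (\<gamma> u) (velocity A \<gamma> u))"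

text \<open>Covariant derivative of a vector field \<open>V\<close> along \<open>\<gamma>\<close>. In the chart around \<open>\<gamma> t\<close>, with coordinate
  fields \<open>E\<^sub>i\<close>, it is \<open>\<Sum>\<^sub>i (V\<^sup>i)' E\<^sub>i + V\<^sup>i \<nabla>\<^bsub>\<gamma>'\<^esub> E\<^sub>i\<close>; the second part is the covariant derivative of the
  field with the constant components \<open>V\<^sup>i(t)\<close>.\<close>

definition cov_deriv_along ::
  "('m, 'k::finite) chart set \<Rightarrow> ('m, 'k) connection \<Rightarrow> (real \<Rightarrow> 'm) \<Rightarrow> (real \<Rightarrow> real ^ 'k) \<Rightarrow>
   real \<Rightarrow> real ^ 'k" where
  "cov_deriv_along A N \<gamma> V t =
     vector_derivative (\<lambda>u. components A (chart_at A (\<gamma> t)) (\<gamma> u) (V u)) (at t)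
     + N (\<gamma> t) (velocity A \<gamma> t) (const_ext A (\<gamma> t) (V t))"

definition is_partition :: "real \<Rightarrow> real \<Rightarrow> nat \<Rightarrow> (nat \<Rightarrow> real) \<Rightarrow> bool" where
  "is_partition a b k t \<longleftrightarrow> t 0 = a \<and> t k = b \<and> (\<forall>j<k. t j < t (Suc j))"

definition piecewise_smooth_curve ::
  "('m::topological_space, 'k::finite) chart set \<Rightarrow> real \<Rightarrow> real \<Rightarrow> (real \<Rightarrow> 'm) \<Rightarrow> bool" where
  "piecewise_smooth_curve A a b \<gamma> \<longleftrightarrow>
     (\<exists>k t. is_partition a b k t \<and> (\<forall>j<k. smooth_map_into A {t j..t (Suc j)} \<gamma>))"

definition tangent_norm ::
  "('m \<Rightarrow> real ^ 'k \<Rightarrow> real ^ 'k \<Rightarrow> real) \<Rightarrow> 'm \<Rightarrow> real ^ 'k \<Rightarrow> real" where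
  "tangent_norm g p v = sqrt (g p v v)"

text \<open>At the finitely many break points (and at \<open>a\<close>, \<open>b\<close>) the velocity need not exist; these points
  do not matter for the integral.\<close>

definition curve_length ::
  "('m, 'k::finite) chart set \<Rightarrow> ('m \<Rightarrow> real ^ 'k \<Rightarrow> real ^ 'k \<Rightarrow> real) \<Rightarrow> real \<Rightarrow> real \<Rightarrow>
   (real \<Rightarrow> 'm) \<Rightarrow> real" where
  "curve_length A g a b \<gamma> = integral {a..b} (\<lambda>t. tangent_norm g (\<gamma> t) (velocity A \<gamma> t))"

definition curve_space ::
  "('m::topological_space, 'k::finite) chart set \<Rightarrow> ('m \<Rightarrow> real ^ 'k \<Rightarrow> real ^ 'k \<Rightarrow> real) \<Rightarrow>
   real \<Rightarrow> real \<Rightarrow> 'm \<Rightarrow> 'm \<Rightarrow> (real \<Rightarrow> 'm) set" where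
  "curve_space A g a b y z = {\<gamma>. piecewise_smooth_curve A a b \<gamma> \<and> \<gamma> a = y \<and> \<gamma> b = z \<and>
     (\<exists>r. \<forall>t\<in>{a..b}. curve_length A g a t \<gamma> = r * (t - a))}"

text \<open>A vector field along \<open>\<gamma>\<close> is a function \<open>X\<close> with \<open>X t\<close> a tangent vector at \<open>\<gamma> t\<close>.\<close>

definition smooth_vf_along ::
  "('m::topological_space, 'k::finite) chart set \<Rightarrow> (real \<Rightarrow> 'm) \<Rightarrow> real set \<Rightarrow> (real \<Rightarrow> real ^ 'k) \<Rightarrow> bool" where
  "smooth_vf_along A \<gamma> S X \<longleftrightarrow> (\<forall>t\<in>S. \<exists>c\<in>A. \<exists>V. open V \<and> t \<in> V \<and> \<gamma> ` (V \<inter> S) \<subseteq> cdom c \<and>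
     smooth_on (V \<inter> S) (\<lambda>u. components A c (\<gamma> u) (X u)))"

definition curve_space_tangent ::
  "('m::topological_space, 'k::finite) chart set \<Rightarrow> real \<Rightarrow> real \<Rightarrow> (real \<Rightarrow> 'm) \<Rightarrow>
   (real \<Rightarrow> real ^ 'k) set" where
  "curve_space_tangent A a b \<gamma> = {X. X a = 0 \<and> X b = 0 \<and>
     (\<exists>k t. is_partition a b k t \<and> (\<forall>j<k. smooth_vf_along A \<gamma> {t j..t (Suc j)} X))}"

text \<open>\<open>F s\<close>, for \<open>\<bar>s\<bar> < \<epsilon>\<close>, is a family of curves in the curve space through \<open>\<gamma>\<close> with
  variation field \<open>X\<close>.\<close>

definition variation ::
  "('m::topological_space, 'k::finite) chart set \<Rightarrow> ('m \<Rightarrow> real ^ 'k \<Rightarrow> real ^ 'k \<Rightarrow> real) \<Rightarrow>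
   real \<Rightarrow> real \<Rightarrow> 'm \<Rightarrow> 'm \<Rightarrow> (real \<Rightarrow> 'm) \<Rightarrow> (real \<Rightarrow> real ^ 'k) \<Rightarrow> real \<Rightarrow>
   (real \<Rightarrow> real \<Rightarrow> 'm) \<Rightarrow> bool" where
  "variation A g a b y z \<gamma> X \<epsilon> F \<longleftrightarrow> \<epsilon> > 0 \<and>
     (\<forall>s. \<bar>s\<bar> < \<epsilon> \<longrightarrow> F s \<in> curve_space A g a b y z) \<and>
     (\<forall>t\<in>{a..b}. F 0 t = \<gamma> t) \<and>
     (\<exists>k t. is_partition a b k t \<and>
        (\<forall>j<k. smooth_map_into A ({t j..t (Suc j)} \<times> {-\<epsilon><..<\<epsilon>}) (\<lambda>(u, s). F s u))) \<and>
     (\<forall>t\<in>{a..b}. velocity A (\<lambda>s. F s t) 0 = X t)"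

end

theory Submission
  imports Defs
begin

text \<open>Let \<open>\<partial>\<^sub>t\<close>, \<open>\<partial>\<^sub>s\<close> be the two velocity
  fields of the variation. Symmetry of mixed partials gives
  \<open>\<nabla>\<^sub>s \<partial>\<^sub>t = \<nabla>\<^sub>t \<partial>\<^sub>s + T(\<partial>\<^sub>s, \<partial>\<^sub>t)\<close>, so, since \<open>\<nabla> g = 0\<close>,
  \<open>1/2 d/ds g(\<partial>\<^sub>t, \<partial>\<^sub>t) = d/dt g(\<partial>\<^sub>s, \<partial>\<^sub>t) - g(\<partial>\<^sub>s, \<nabla>\<^sub>t \<partial>\<^sub>t) + g(T(\<partial>\<^sub>s, \<partial>\<^sub>t), \<partial>\<^sub>t)\<close>.
  On an interval so short that the family stays in one chart, differentiation under the integral sign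
  and integration of the total derivative give the formula with boundary terms. The formula is additive
  in the interval once the jumps of the velocity are added, so a bisection argument extends it to \<open>[a, b]\<close>.\<close>

section \<open>Calculus of smooth maps\<close>

text \<open>Tangent vectors are written in \<open>chart_at A p\<close>, which jumps with
  \<open>p\<close>, so they cannot be differentiated as they stand. Everything is rewritten through
  a fixed chart \<open>d\<close> by \<open>chart_field\<close>; velocities then become partial
  derivatives of one smooth map \<open>f\<close> between normed spaces. Covariant terms are simplest
  in the preferred chart of the point in question, where \<open>chart_field\<close> is the identity.
  The two views are joined because g(\<partial>t, \<partial>t) and g(\<partial>s, \<partial>t) are
  functions of (t, s) alone, with derivatives that do not depend on the chart. A second obstacle is
  the ends of the smooth pieces, where the two-sided \<open>velocity\<close> may be meaningless.
  Identities are proved on open intervals; integrals ignore the ends, continuity carries the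
  constant speed to them, and the boundary terms come from the smooth extension \<open>f\<close>,
  whose t-derivative there is the one-sided limit of the velocity. Constant speed r > 0 does two
  jobs: it keeps the square root differentiable near s = 0, and it turns the factor 1/(2 sqrt E)
  into 1/(2 r), so that 1/r leaves the integral.\<close>

lemma Ck_on_cong:
  assumes "open U" "\<And>x. x \<in> U \<Longrightarrow> f x = g x" "Ck_on k U f"
  shows "Ck_on k U g"
  using assms
proof (induction k arbitrary: f g)
  case 0
  then show ?case
    by (metis Ck_on.simps(1) continuous_on_cong)
next
  case (Suc k)
  have diff: "\<forall>x\<in>U. f differentiable (at x)" and ck: "\<And>v. Ck_on k U (\<lambda>x. frechet_derivative f (at x) v)"
    using Suc.prems by auto
  have eq: "frechet_derivative f (at x) = frechet_derivative g (at x)" if "x \<in> U" for x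
    using frechet_derivative_transform_within_open[of f x U g] diff that Suc.prems by auto
  have "g differentiable (at x)" if "x \<in> U" for x
    by (metis Suc.prems(1,2) diff differentiable_def has_derivative_transform_within_open that)
  moreover have "Ck_on k U (\<lambda>x. frechet_derivative g (at x) v)" for v
    by (rule Suc.IH[OF Suc.prems(1) _ ck]) (simp add: eq)
  ultimately show ?case by simp
qed

lemma Ck_on_subset:
  assumes "Ck_on k U f" "V \<subseteq> U"
  shows "Ck_on k V f"
  using assms by (induction k arbitrary: f) (auto intro: continuous_on_subset)

lemma Ck_on_Suc_imp:
  assumes "Ck_on (Suc k) U f"
  shows "Ck_on k U f"
  using assms
proof (induction k arbitrary: f)
  case 0
  then show ?case
    by (auto intro!: continuous_at_imp_continuous_on differentiable_imp_continuous_within)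
qed simp

lemma Ck_on_const: "Ck_on k U (\<lambda>x. c)"
  by (induction k arbitrary: c) auto

lemma Ck_on_bounded_linear:
  assumes "bounded_linear f"
  shows "Ck_on k U f"
proof (cases k)
  case 0
  then show ?thesis
    using assms by (simp add: linear_continuous_on)
next
  case (Suc n)
  have "(f has_derivative f) (at x)" for x
    by (rule bounded_linear_imp_has_derivative[OF assms])
  then have "f differentiable (at x)" "frechet_derivative f (at x) = f" for x
    by (auto simp: differentiable_def frechet_derivative_at[symmetric])
  then show ?thesis
    using Suc by (simp add: Ck_on_const)
qed

text \<open>Lets the inductions over \<open>k\<close> work with a derivative written out by a rule
  of calculus; uniqueness of derivatives identifies it with
  \<open>frechet_derivative\<close>.\<close>

lemma Ck_on_SucI:
  assumes "open U"
    and "\<And>x. x \<in> U \<Longrightarrow> (f has_derivative f' x) (at x)"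
    and "\<And>v. Ck_on k U (\<lambda>x. f' x v)"
  shows "Ck_on (Suc k) U f"
proof -
  have "frechet_derivative f (at x) = f' x" if "x \<in> U" for x
    using assms(2)[OF that] frechet_derivative_at by metis
  moreover have "Ck_on k U (\<lambda>x. frechet_derivative f (at x) v)" for v
    by (rule Ck_on_cong[OF assms(1) _ assms(3)[of v]]) (simp add: calculation)
  ultimately show ?thesis
    using assms(2) by (auto simp: differentiable_def)
qed

lemma Ck_on_SucD:
  assumes "Ck_on (Suc k) U f" "x \<in> U"
  shows "(f has_derivative frechet_derivative f (at x)) (at x)"
  using assms by (simp add: frechet_derivative_works[symmetric])

lemma Ck_on_add:
  assumes "open U" "Ck_on k U f" "Ck_on k U g"
  shows "Ck_on k U (\<lambda>x. f x + g x)"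
  using assms(2,3)
proof (induction k arbitrary: f g)
  case 0
  then show ?case by (simp add: continuous_on_add)
next
  case (Suc k)
  show ?case
    by (rule Ck_on_SucI[OF assms(1)])
       (use Suc in \<open>auto intro!: derivative_eq_intros Ck_on_SucD[OF Suc.prems(1)] Ck_on_SucD[OF Suc.prems(2)]\<close>)
qed

lemma Ck_on_sum:
  assumes "open U" "\<And>i. i \<in> I \<Longrightarrow> Ck_on k U (f i)"
  shows "Ck_on k U (\<lambda>x. \<Sum>i\<in>I. f i x)"
  using assms(2)
  by (induction I rule: infinite_finite_induct) (auto simp: Ck_on_const intro!: Ck_on_add[OF assms(1)])

lemma Ck_on_scaleR:
  assumes "open U" "Ck_on k U f" "Ck_on k U g"
  shows "Ck_on k U (\<lambda>x. f x *\<^sub>R g x)"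
  using assms(2,3)
proof (induction k arbitrary: f g)
  case 0
  then show ?case by (simp add: continuous_on_scaleR)
next
  case (Suc k)
  \<comment> \<open>The product rule leaves one factor undifferentiated in each term; the induction
    hypothesis needs that factor at level \<open>k\<close>.\<close>
  have 1: "Ck_on k U f" "Ck_on k U g"
    using Suc.prems Ck_on_Suc_imp by blast+
  show ?case
  proof (rule Ck_on_SucI[OF assms(1)])
    show "((\<lambda>x. f x *\<^sub>R g x) has_derivative
       (\<lambda>v. f x *\<^sub>R frechet_derivative g (at x) v + frechet_derivative f (at x) v *\<^sub>R g x)) (at x)"
      if "x \<in> U" for x
      by (rule derivative_eq_intros Ck_on_SucD[OF Suc.prems(1) that] Ck_on_SucD[OF Suc.prems(2) that] refl)+
    show "Ck_on k U (\<lambda>x. f x *\<^sub>R frechet_derivative g (at x) v + frechet_derivative f (at x) v *\<^sub>R g x)" for v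
      using Suc.prems 1 by (intro Ck_on_add[OF assms(1)] Suc.IH) auto
  qed
qed

lemma Ck_on_inner_const:
  assumes "open U" "Ck_on k U f"
  shows "Ck_on k U (\<lambda>x. f x \<bullet> b)"
  using assms(2)
proof (induction k arbitrary: f)
  case 0
  then show ?case by (auto intro!: continuous_intros)
next
  case (Suc k)
  show ?case
    by (rule Ck_on_SucI[OF assms(1)])
       (use Suc in \<open>auto intro!: derivative_eq_intros Ck_on_SucD[OF Suc.prems(1)]\<close>)
qed

text \<open>In the chain rule the direction in which \<open>f\<close> is differentiated varies with
  \<open>x\<close>, so the induction hypothesis does not apply directly. Expanding this direction in
  a basis of the middle space leaves scalar coefficients times partial derivatives of
  \<open>f\<close> in fixed directions, composed with \<open>g\<close>.\<close>

lemma Ck_on_compose: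
  fixes g :: "'a::real_normed_vector \<Rightarrow> 'b::euclidean_space" and f :: "'b \<Rightarrow> 'c::real_normed_vector"
  assumes "open U" "Ck_on k V f" "Ck_on k U g" "g ` U \<subseteq> V"
  shows "Ck_on k U (f \<circ> g)"
  using assms(2,3)
proof (induction k arbitrary: f)
  case 0
  then show ?case
    using assms(4) by (metis Ck_on.simps(1) continuous_on_compose continuous_on_subset)
next
  case (Suc k)
  have gk: "Ck_on k U g"
    using Suc.prems Ck_on_Suc_imp by blast
  have f': "(f has_derivative frechet_derivative f (at (g x))) (at (g x))" if "x \<in> U" for x
    using assms(4) that by (intro Ck_on_SucD[OF Suc.prems(1)]) auto
  show ?case
  proof (rule Ck_on_SucI[OF assms(1)])
    fix x assume x: "x \<in> U"
    show "(f \<circ> g has_derivative (\<lambda>v. \<Sum>b\<in>Basis. (frechet_derivative g (at x) v \<bullet> b) *\<^sub>R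
        frechet_derivative f (at (g x)) b)) (at x)"
    proof (rule has_derivative_eq_rhs[OF diff_chain_at[OF Ck_on_SucD[OF Suc.prems(2) x] f'[OF x]]], rule ext)
      fix v
      have lin: "linear (frechet_derivative f (at (g x)))"
        using f'[OF x] has_derivative_linear by blast
      let ?w = "frechet_derivative g (at x) v"
      have "frechet_derivative f (at (g x)) ?w = frechet_derivative f (at (g x)) (\<Sum>b\<in>Basis. (?w \<bullet> b) *\<^sub>R b)"
        by (simp add: euclidean_representation)
      also have "\<dots> = (\<Sum>b\<in>Basis. (?w \<bullet> b) *\<^sub>R frechet_derivative f (at (g x)) b)"
        by (simp add: linear_sum[OF lin] linear_cmul[OF lin])
      finally show "(frechet_derivative f (at (g x)) \<circ> frechet_derivative g (at x)) v =
        (\<Sum>b\<in>Basis. (?w \<bullet> b) *\<^sub>R frechet_derivative f (at (g x)) b)" by simp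
    qed
  next
    fix v
    have 1: "Ck_on k U ((\<lambda>y. frechet_derivative f (at y) b) \<circ> g)" for b
      using Suc.prems gk by (intro Suc.IH) auto
    show "Ck_on k U (\<lambda>x. \<Sum>b\<in>Basis. (frechet_derivative g (at x) v \<bullet> b) *\<^sub>R
        frechet_derivative f (at (g x)) b)"
      using Suc.prems 1
      by (intro Ck_on_sum Ck_on_scaleR Ck_on_inner_const assms(1)) (auto simp: o_def)
  qed
qed

section \<open>Smooth maps: closure properties and derivatives\<close>

lemma smooth_on_open_iff: "open U \<Longrightarrow> smooth_on U f \<longleftrightarrow> (\<forall>k. Ck_on k U f)"
proof
  assume "open U" "smooth_on U f"
  then show "\<forall>k. Ck_on k U f"
    unfolding smooth_on_def by (metis Ck_on_cong Ck_on_subset)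
next
  assume "open U" "\<forall>k. Ck_on k U f"
  then show "smooth_on U f"
    unfolding smooth_on_def by (intro exI[of _ U] exI[of _ f]) auto
qed

lemma smooth_on_subset: "smooth_on S f \<Longrightarrow> T \<subseteq> S \<Longrightarrow> smooth_on T f"
  unfolding smooth_on_def by blast

lemma smooth_on_cong: "(\<And>x. x \<in> S \<Longrightarrow> f x = g x) \<Longrightarrow> smooth_on S f \<Longrightarrow> smooth_on S g"
  unfolding smooth_on_def by metis

lemma smooth_on_compose:
  fixes g :: "'a::real_normed_vector \<Rightarrow> 'b::euclidean_space" and f :: "'b \<Rightarrow> 'c::real_normed_vector"
  assumes "open U" "open V" "smooth_on V f" "smooth_on U g" "g ` U \<subseteq> V"
  shows "smooth_on U (f \<circ> g)"
  unfolding smooth_on_open_iff[OF assms(1)]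
proof
  show "Ck_on k U (f \<circ> g)" for k
    using assms(3,4) unfolding smooth_on_open_iff[OF assms(1)] smooth_on_open_iff[OF assms(2)]
    by (intro Ck_on_compose[OF assms(1) _ _ assms(5)]) blast+
qed

lemma smooth_on_sum:
  "open U \<Longrightarrow> (\<And>i. i \<in> I \<Longrightarrow> smooth_on U (f i)) \<Longrightarrow> smooth_on U (\<lambda>x. \<Sum>i\<in>I. f i x)"
  by (simp add: smooth_on_open_iff Ck_on_sum)

lemma smooth_on_scaleR:
  "open U \<Longrightarrow> smooth_on U f \<Longrightarrow> smooth_on U g \<Longrightarrow> smooth_on U (\<lambda>x. f x *\<^sub>R g x)"
  by (simp add: smooth_on_open_iff Ck_on_scaleR)

lemma smooth_on_inner_const:
  "open U \<Longrightarrow> smooth_on U f \<Longrightarrow> smooth_on U (\<lambda>x. f x \<bullet> b)"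
  by (simp add: smooth_on_open_iff Ck_on_inner_const)

lemma smooth_on_bounded_linear: "bounded_linear f \<Longrightarrow> smooth_on U f"
  unfolding smooth_on_def using Ck_on_bounded_linear[of f _ UNIV] by blast

lemma smooth_on_frechet_derivative:
  assumes "open U" "smooth_on U f"
  shows "smooth_on U (\<lambda>x. frechet_derivative f (at x) v)"
proof -
  have "Ck_on (Suc k) U f" for k
    using assms smooth_on_open_iff by blast
  then show ?thesis
    using assms(1) by (simp add: smooth_on_open_iff)
qed

lemma smooth_on_has_derivative:
  assumes "open U" "smooth_on U f" "x \<in> U"
  shows "(f has_derivative frechet_derivative f (at x)) (at x)"
  using assms Ck_on_SucD[of 0] smooth_on_open_iff by blast

lemma smooth_on_continuous_on:
  assumes "smooth_on S f"
  shows "continuous_on S f"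
proof -
  obtain U F where "S \<subseteq> U" "Ck_on 0 U F" "\<forall>x\<in>S. F x = f x"
    using assms unfolding smooth_on_def by blast
  then show ?thesis
    by (metis Ck_on.simps(1) continuous_on_cong continuous_on_subset)
qed

section \<open>Partial derivatives and their symmetry\<close>

lemma has_vector_derivative_slice1:
  assumes "(f has_derivative D) (at (u, s))"
  shows "((\<lambda>u. f (u, s)) has_vector_derivative D (1, 0)) (at u)"
proof -
  have "((\<lambda>u. f (u, s)) has_derivative (\<lambda>h. D (h, 0))) (at u)"
    by (rule has_derivative_compose[where f="\<lambda>u. (u, s)" and g=f, OF _ assms])
       (intro has_derivative_Pair has_derivative_ident has_derivative_const)
  moreover have "(\<lambda>h. D (h, 0)) = (\<lambda>h. h *\<^sub>R D (1, 0))"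
    using linear_cmul[OF has_derivative_linear[OF assms], of _ "(1, 0)"] by (intro ext) (metis scaleR_Pair scaleR_zero_right mult.right_neutral real_scaleR_def)
  ultimately show ?thesis
    unfolding has_vector_derivative_def by simp
qed

lemma has_vector_derivative_slice2:
  assumes "(f has_derivative D) (at (u, s))"
  shows "((\<lambda>s. f (u, s)) has_vector_derivative D (0, 1)) (at s)"
proof -
  have "((\<lambda>s. f (u, s)) has_derivative (\<lambda>h. D (0, h))) (at s)"
    by (rule has_derivative_compose[where f="\<lambda>s. (u, s)" and g=f, OF _ assms])
       (intro has_derivative_Pair has_derivative_ident has_derivative_const)
  moreover have "(\<lambda>h. D (0, h)) = (\<lambda>h. h *\<^sub>R D (0, 1))"
    using linear_cmul[OF has_derivative_linear[OF assms], of _ "(0, 1)"] by (intro ext) (metis scaleR_Pair scaleR_zero_right mult.right_neutral real_scaleR_def)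
  ultimately show ?thesis
    unfolding has_vector_derivative_def by simp
qed

text \<open>Schwarz: differentiate \<open>f (u, s) = f (u\<^sub>0, s) + \<integral> \<partial>\<^sub>u f (\<cdot>, s)\<close> under the integral in
  \<open>s\<close>, then differentiate the result in \<open>u\<close>.\<close>

lemma mixed_partials_real:
  fixes f :: "real \<times> real \<Rightarrow> real"
  assumes W: "open W" and f: "smooth_on W f" and z: "(u0, s0) \<in> W"
  shows "frechet_derivative (\<lambda>z. frechet_derivative f (at z) (0, 1)) (at (u0, s0)) (1, 0) =
         frechet_derivative (\<lambda>z. frechet_derivative f (at z) (1, 0)) (at (u0, s0)) (0, 1)"
proof -
  define fu where "fu = (\<lambda>z. frechet_derivative f (at z) (1, 0))"
  define fs where "fs = (\<lambda>z. frechet_derivative f (at z) (0, 1))"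
  define fus where "fus = (\<lambda>z. frechet_derivative fu (at z) (0, 1))"
  have sm: "smooth_on W fu" "smooth_on W fs" "smooth_on W fus"
    unfolding fu_def fs_def fus_def by (intro smooth_on_frechet_derivative W f)+
  \<comment> \<open>A closed rectangle inside \<open>W\<close>: the integration in \<open>u\<close>
    starts at its left edge \<open>p\<close>, while \<open>s\<close> runs over the open interval
    \<open>V\<close>.\<close>
  obtain e where e: "e > 0" "cball u0 e \<times> cball s0 e \<subseteq> W"
  proof -
    obtain A B where AB: "open A" "open B" "u0 \<in> A" "s0 \<in> B" "A \<times> B \<subseteq> W"
      using W z unfolding open_prod_def by fastforce
    obtain e1 where e1: "e1 > 0" "cball u0 e1 \<subseteq> A" using AB open_contains_cball by blast
    obtain e2 where e2: "e2 > 0" "cball s0 e2 \<subseteq> B" using AB open_contains_cball by blast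
    have "cball u0 (min e1 e2) \<times> cball s0 (min e1 e2) \<subseteq> W"
      using e1 e2 AB by fastforce
    then show ?thesis using that[of "min e1 e2"] e1 e2 by simp
  qed
  define p where "p = u0 - e"
  define q where "q = u0 + e"
  define V where "V = {s0 - e<..<s0 + e}"
  have in_W: "(u, s) \<in> W" if "u \<in> {p..q}" "s \<in> {s0 - e..s0 + e}" for u s
    using e that unfolding p_def q_def by (auto simp: dist_real_def abs_le_iff subset_iff)
  have VW: "(u, s) \<in> W" if "u \<in> {p..q}" "s \<in> V" for u s
    using in_W that unfolding V_def by auto
  have s0: "s0 \<in> V" "open V" "convex V" using e by (auto simp: V_def)
  have pq: "p < u0" "u0 < q" using e by (auto simp: p_def q_def)
  have du: "((\<lambda>u. f (u, s)) has_vector_derivative fu (u, s)) (at u)" if "(u, s) \<in> W" for u s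
    unfolding fu_def by (rule has_vector_derivative_slice1[OF smooth_on_has_derivative[OF W f that]])
  have ds: "((\<lambda>s. f (u, s)) has_vector_derivative fs (u, s)) (at s)" if "(u, s) \<in> W" for u s
    unfolding fs_def by (rule has_vector_derivative_slice2[OF smooth_on_has_derivative[OF W f that]])
  have dus: "((\<lambda>s. fu (u, s)) has_vector_derivative fus (u, s)) (at s)" if "(u, s) \<in> W" for u s
    unfolding fus_def by (rule has_vector_derivative_slice2[OF smooth_on_has_derivative[OF W sm(1) that]])
  have cont: "continuous_on {p..q} (\<lambda>u. \<phi> (u, s))" if "continuous_on W \<phi>" "s \<in> V" for \<phi> :: "real \<times> real \<Rightarrow> real" and s
    by (rule continuous_on_compose2[OF that(1)]) (use VW that in \<open>auto intro!: continuous_intros\<close>)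
  have FTC: "integral {p..u} (\<lambda>v. fu (v, s)) = f (u, s) - f (p, s)" if "u \<in> {p..q}" "s \<in> V" for u s
    by (rule integral_unique, rule fundamental_theorem_of_calculus)
       (use that VW in \<open>auto intro!: has_vector_derivative_at_within du\<close>)
  have key: "fs (u, s0) = fs (p, s0) + integral {p..u} (\<lambda>v. fus (v, s0))" if u: "u \<in> {p..q}" for u
  proof -
    have "((\<lambda>s. integral (cbox p u) (\<lambda>v. fu (v, s))) has_field_derivative
        integral (cbox p u) (\<lambda>v. fus (v, s0))) (at s0 within V)"
    proof (rule leibniz_rule_field_derivative)
      show "((\<lambda>s. fu (v, s)) has_real_derivative fus (v, s)) (at s within V)" if "s \<in> V" "v \<in> cbox p u" for s v
        using dus[of v s] VW[of v s] that u
        by (auto simp: has_real_derivative_iff_has_vector_derivative intro: has_vector_derivative_at_within)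
      show "(\<lambda>v. fu (v, s)) integrable_on cbox p u" if "s \<in> V" for s
        using cont[OF smooth_on_continuous_on[OF sm(1)] that] u
        by (auto intro!: integrable_continuous_real intro: continuous_on_subset)
      show "continuous_on (V \<times> cbox p u) (\<lambda>(s, v). fus (v, s))"
        unfolding split_beta
        by (rule continuous_on_compose2[OF smooth_on_continuous_on[OF sm(3)]])
           (use VW u in \<open>auto intro!: continuous_intros\<close>)
    qed (use s0 in auto)
    then have "((\<lambda>s. integral {p..u} (\<lambda>v. fu (v, s))) has_real_derivative
        integral {p..u} (\<lambda>v. fus (v, s0))) (at s0)"
      using at_within_open[OF s0(1,2)] by (simp only: cbox_interval)
    moreover have "((\<lambda>s. integral {p..u} (\<lambda>v. fu (v, s))) has_real_derivative
       fs (u, s0) - fs (p, s0)) (at s0)"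
    proof (rule has_field_derivative_transform_within_open[where S=V])
      show "((\<lambda>s. f (u, s) - f (p, s)) has_real_derivative fs (u, s0) - fs (p, s0)) (at s0)"
        unfolding has_real_derivative_iff_has_vector_derivative
        by (intro has_vector_derivative_diff ds VW s0) (use u pq in auto)
    qed (use s0 FTC u in auto)
    ultimately have "integral {p..u} (\<lambda>v. fus (v, s0)) = fs (u, s0) - fs (p, s0)"
      by (rule DERIV_unique)
    then show ?thesis by simp
  qed
  \<comment> \<open>The derivative of the indefinite integral comes only within [p, q]; as
    \<open>u0\<close> is an interior point, passing to the open interval makes it two-sided.\<close>
  have "((\<lambda>u. integral {p..u} (\<lambda>v. fus (v, s0))) has_vector_derivative fus (u0, s0)) (at u0 within {p..q})"
    by (rule integral_has_vector_derivative) (use cont sm s0 smooth_on_continuous_on pq in auto)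
  then have "((\<lambda>u. fs (p, s0) + integral {p..u} (\<lambda>v. fus (v, s0))) has_vector_derivative fus (u0, s0)) (at u0 within {p<..<q})"
    by (auto intro!: derivative_eq_intros intro: has_vector_derivative_within_subset)
  then have "((\<lambda>u. fs (p, s0) + integral {p..u} (\<lambda>v. fus (v, s0))) has_vector_derivative fus (u0, s0)) (at u0)"
    using at_within_open[of u0 "{p<..<q}"] pq by simp
  then have "((\<lambda>u. fs (u, s0)) has_vector_derivative fus (u0, s0)) (at u0)"
    by (rule has_vector_derivative_transform_within_open[where S="{p<..<q}"]) (use pq in \<open>auto simp: key[symmetric]\<close>)
  moreover have "((\<lambda>u. fs (u, s0)) has_vector_derivative frechet_derivative fs (at (u0, s0)) (1, 0)) (at u0)"
    by (rule has_vector_derivative_slice1[OF smooth_on_has_derivative[OF W sm(2) z]])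
  ultimately have "fus (u0, s0) = frechet_derivative fs (at (u0, s0)) (1, 0)"
    by (rule vector_derivative_unique_at)
  then show ?thesis
    unfolding fus_def fu_def fs_def by (rule sym)
qed

lemma frechet_derivative_inner_const:
  assumes "f differentiable (at x)"
  shows "frechet_derivative (\<lambda>x. f x \<bullet> b) (at x) v = frechet_derivative f (at x) v \<bullet> b"
proof -
  have "((\<lambda>x. f x \<bullet> b) has_derivative (\<lambda>v. frechet_derivative f (at x) v \<bullet> b)) (at x)"
    using assms by (auto intro!: derivative_eq_intros simp: frechet_derivative_works)
  then show ?thesis
    using frechet_derivative_at by metis
qed

text \<open>Reduced to real functions along each basis vector \<open>b\<close>. The inner product
  with \<open>b\<close> commutes with the first differentiation on all of \<open>W\<close>, not just
  at the point, which is what the second differentiation requires.\<close>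

lemma mixed_partials:
  fixes f :: "real \<times> real \<Rightarrow> 'a::euclidean_space"
  assumes W: "open W" and f: "smooth_on W f" and z: "(u, s) \<in> W"
  shows "frechet_derivative (\<lambda>z. frechet_derivative f (at z) (0, 1)) (at (u, s)) (1, 0) =
         frechet_derivative (\<lambda>z. frechet_derivative f (at z) (1, 0)) (at (u, s)) (0, 1)"
proof (rule euclidean_eqI)
  fix b :: 'a
  have d1: "g differentiable (at z)" if "smooth_on W g" "z \<in> W" for g :: "real \<times> real \<Rightarrow> 'a" and z
    using smooth_on_has_derivative[OF W that] differentiable_def by blast
  have eq: "frechet_derivative (\<lambda>z. frechet_derivative (\<lambda>x. f x \<bullet> b) (at z) v) (at (u, s)) w =
    frechet_derivative (\<lambda>z. frechet_derivative f (at z) v) (at (u, s)) w \<bullet> b" for v w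
  proof -
    have 1: "frechet_derivative f (at z) v \<bullet> b = frechet_derivative (\<lambda>x. f x \<bullet> b) (at z) v"
      if "z \<in> W" for z
      using frechet_derivative_inner_const[OF d1[OF f that]] by simp
    have s: "smooth_on W (\<lambda>z. frechet_derivative f (at z) v)"
      by (intro smooth_on_frechet_derivative W f)
    have "frechet_derivative (\<lambda>z. frechet_derivative f (at z) v \<bullet> b) (at (u, s)) =
      frechet_derivative (\<lambda>z. frechet_derivative (\<lambda>x. f x \<bullet> b) (at z) v) (at (u, s))"
      by (rule frechet_derivative_transform_within_open[OF _ W z])
         (use 1 smooth_on_has_derivative[OF W smooth_on_inner_const[OF W s] z] in \<open>auto simp: differentiable_def\<close>)
    then show ?thesis
      using frechet_derivative_inner_const[OF d1[OF s z], of b w] by simp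
  qed
  show "frechet_derivative (\<lambda>z. frechet_derivative f (at z) (0, 1)) (at (u, s)) (1, 0) \<bullet> b =
         frechet_derivative (\<lambda>z. frechet_derivative f (at z) (1, 0)) (at (u, s)) (0, 1) \<bullet> b"
    using mixed_partials_real[OF W smooth_on_inner_const[OF W f, of b] z] by (simp add: eq)
qed

section \<open>Families of bilinear forms\<close>

text \<open>A metric is known to be smooth only on fixed arguments. The expansion moves the
  dependence on the base point into coefficients with fixed arguments, so that smoothness and
  derivatives with moving vectors follow from sums and products.\<close>

lemma bilinear_euclidean_expansion:
  fixes B :: "'c::euclidean_space \<Rightarrow> 'c \<Rightarrow> real"
  assumes "bilinear B"
  shows "B v w = (\<Sum>i\<in>Basis. \<Sum>j\<in>Basis. (v \<bullet> i) *\<^sub>R (w \<bullet> j) *\<^sub>R B i j)"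
proof -
  have l: "linear (\<lambda>v. B v w)" "linear (\<lambda>w. B v w)" for v w
    using assms by (auto simp: bilinear_def)
  have "B v w = B (\<Sum>i\<in>Basis. (v \<bullet> i) *\<^sub>R i) w"
    by (simp add: euclidean_representation)
  also have "\<dots> = (\<Sum>i\<in>Basis. (v \<bullet> i) *\<^sub>R B i w)"
    by (simp add: linear_sum[OF l(1)] linear_cmul[OF l(1)])
  also have "\<dots> = (\<Sum>i\<in>Basis. (v \<bullet> i) *\<^sub>R B i (\<Sum>j\<in>Basis. (w \<bullet> j) *\<^sub>R j))"
    by (simp add: euclidean_representation)
  also have "\<dots> = (\<Sum>i\<in>Basis. \<Sum>j\<in>Basis. (v \<bullet> i) *\<^sub>R (w \<bullet> j) *\<^sub>R B i j)"
    by (simp add: linear_sum[OF l(2)] linear_cmul[OF l(2)] sum_distrib_left)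
  finally show ?thesis .
qed

lemma smooth_on_bilinear_family:
  fixes G :: "'b::euclidean_space \<Rightarrow> 'c::euclidean_space \<Rightarrow> 'c \<Rightarrow> real"
    and \<kappa> :: "'a::real_normed_vector \<Rightarrow> 'b"
  assumes "open \<Omega>" and bil: "\<And>y. y \<in> \<Omega> \<Longrightarrow> bilinear (G y)"
    and G: "\<And>v w. smooth_on \<Omega> (\<lambda>y. G y v w)"
    and W: "open W" and "smooth_on W \<kappa>" "smooth_on W V1" "smooth_on W V2" "\<kappa> ` W \<subseteq> \<Omega>"
  shows "smooth_on W (\<lambda>x. G (\<kappa> x) (V1 x) (V2 x))"
proof -
  have 1: "smooth_on W (\<lambda>x. G (\<kappa> x) i j)" for i j
    using smooth_on_compose[OF W assms(1) G[of i j] assms(5,8)] by (simp add: o_def)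
  have "smooth_on W (\<lambda>x. \<Sum>i\<in>Basis. \<Sum>j\<in>Basis. (V1 x \<bullet> i) *\<^sub>R (V2 x \<bullet> j) *\<^sub>R G (\<kappa> x) i j)"
    by (intro smooth_on_sum smooth_on_scaleR smooth_on_inner_const W 1 assms)
  then show ?thesis
    by (rule smooth_on_cong[rotated]) (rule bilinear_euclidean_expansion[symmetric, OF bil], use assms(8) in auto)
qed

text \<open>The product rule for three varying ingredients. For a metric in coordinates, the first
  term differentiates the coefficients with frozen vectors; that is where the connection will
  enter.\<close>

lemma frechet_derivative_bilinear_family:
  fixes G :: "'b::euclidean_space \<Rightarrow> 'c::euclidean_space \<Rightarrow> 'c \<Rightarrow> real"
    and \<kappa> :: "'a::real_normed_vector \<Rightarrow> 'b"
  assumes "open \<Omega>" and bil: "\<And>y. y \<in> \<Omega> \<Longrightarrow> bilinear (G y)"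
    and G: "\<And>v w. smooth_on \<Omega> (\<lambda>y. G y v w)"
    and W: "open W" and "smooth_on W \<kappa>" "smooth_on W V1" "smooth_on W V2" "\<kappa> ` W \<subseteq> \<Omega>"
    and x: "x \<in> W"
  shows "frechet_derivative (\<lambda>x. G (\<kappa> x) (V1 x) (V2 x)) (at x) h =
    frechet_derivative (\<lambda>y. G y (V1 x) (V2 x)) (at (\<kappa> x)) (frechet_derivative \<kappa> (at x) h)
    + G (\<kappa> x) (frechet_derivative V1 (at x) h) (V2 x)
    + G (\<kappa> x) (V1 x) (frechet_derivative V2 (at x) h)"
proof -
  note d = smooth_on_has_derivative
  have \<kappa>x: "\<kappa> x \<in> \<Omega>" using assms by auto
  define \<kappa>' where "\<kappa>' = frechet_derivative \<kappa> (at x)"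
  define V1' where "V1' = frechet_derivative V1 (at x)"
  define V2' where "V2' = frechet_derivative V2 (at x)"
  define G' where "G' = (\<lambda>i j. frechet_derivative (\<lambda>y. G y i j) (at (\<kappa> x)))"
  have d\<kappa>: "(\<kappa> has_derivative \<kappa>') (at x)" and d1: "(V1 has_derivative V1') (at x)"
    and d2: "(V2 has_derivative V2') (at x)"
    unfolding \<kappa>'_def V1'_def V2'_def by (rule d[OF W _ x], fact)+
  have dG: "((\<lambda>y. G y i j) has_derivative G' i j) (at (\<kappa> x))" for i j
    unfolding G'_def by (intro d[OF assms(1) G \<kappa>x])
  have dG\<kappa>: "((\<lambda>x. G (\<kappa> x) i j) has_derivative (\<lambda>h. G' i j (\<kappa>' h))) (at x)" for i j
    by (rule has_derivative_compose[OF d\<kappa> dG])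
  let ?D = "\<lambda>h. \<Sum>i\<in>Basis. \<Sum>j\<in>Basis. (V1 x \<bullet> i) *\<^sub>R ((V2 x \<bullet> j) *\<^sub>R G' i j (\<kappa>' h) +
        (V2' h \<bullet> j) *\<^sub>R G (\<kappa> x) i j) + (V1' h \<bullet> i) *\<^sub>R (V2 x \<bullet> j) *\<^sub>R G (\<kappa> x) i j"
  have "((\<lambda>x. \<Sum>i\<in>Basis. \<Sum>j\<in>Basis. (V1 x \<bullet> i) *\<^sub>R (V2 x \<bullet> j) *\<^sub>R G (\<kappa> x) i j) has_derivative ?D) (at x)"
    by (intro has_derivative_sum has_derivative_scaleR has_derivative_inner_left d1 d2 dG\<kappa>)
  then have "((\<lambda>x. G (\<kappa> x) (V1 x) (V2 x)) has_derivative ?D) (at x)"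
    by (rule has_derivative_transform_within_open[OF _ W x])
       (rule bilinear_euclidean_expansion[symmetric, OF bil], use assms(8) in auto)
  then have 1: "frechet_derivative (\<lambda>x. G (\<kappa> x) (V1 x) (V2 x)) (at x) h = ?D h"
    by (rule fun_cong[OF frechet_derivative_at[symmetric]])
  \<comment> \<open>With both vectors frozen at \<open>x\<close>, the same expansion recognises the
    \<open>G'\<close> part of \<open>?D\<close> as the derivative of the form itself.\<close>
  have "((\<lambda>y. \<Sum>i\<in>Basis. \<Sum>j\<in>Basis. (V1 x \<bullet> i) *\<^sub>R (V2 x \<bullet> j) *\<^sub>R G y i j) has_derivative
    (\<lambda>h. \<Sum>i\<in>Basis. \<Sum>j\<in>Basis. (V1 x \<bullet> i) *\<^sub>R (V2 x \<bullet> j) *\<^sub>R G' i j h)) (at (\<kappa> x))"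
    by (intro has_derivative_sum has_derivative_scaleR_right dG)
  then have "((\<lambda>y. G y (V1 x) (V2 x)) has_derivative
    (\<lambda>h. \<Sum>i\<in>Basis. \<Sum>j\<in>Basis. (V1 x \<bullet> i) *\<^sub>R (V2 x \<bullet> j) *\<^sub>R G' i j h)) (at (\<kappa> x))"
    by (rule has_derivative_transform_within_open[OF _ assms(1) \<kappa>x])
       (rule bilinear_euclidean_expansion[symmetric, OF bil])
  then have 2: "frechet_derivative (\<lambda>y. G y (V1 x) (V2 x)) (at (\<kappa> x)) (\<kappa>' h) =
     (\<Sum>i\<in>Basis. \<Sum>j\<in>Basis. (V1 x \<bullet> i) *\<^sub>R (V2 x \<bullet> j) *\<^sub>R G' i j (\<kappa>' h))"
    by (rule fun_cong[OF frechet_derivative_at[symmetric]])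
  show ?thesis
    unfolding 1 \<kappa>'_def[symmetric] V1'_def[symmetric] V2'_def[symmetric] 2
      bilinear_euclidean_expansion[OF bil[OF \<kappa>x], of "V1' h" "V2 x"]
      bilinear_euclidean_expansion[OF bil[OF \<kappa>x], of "V1 x" "V2' h"]
    by (simp add: sum.distrib algebra_simps)
qed

section \<open>Charts and velocities\<close>

definition transition_deriv ::
  "('m, 'k::finite) chart \<Rightarrow> ('m, 'k) chart \<Rightarrow> 'm \<Rightarrow> real ^ 'k \<Rightarrow> real ^ 'k" where
  "transition_deriv c d p = frechet_derivative (coord d \<circ> param c) (at (coord c p))"

lemma components_eq: "components A c p = transition_deriv (chart_at A p) c p"
  by (simp add: fun_eq_iff components_def dir_deriv_def transition_deriv_def)

text \<open>The linear combination, with constant coefficients \<open>w\<close>, of the coordinate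
  fields of \<open>d\<close>; each value is converted to the preferred chart of its own point.
  Meaningful on \<open>cdom d\<close>.\<close>

definition chart_field ::
  "('m, 'k::finite) chart set \<Rightarrow> ('m, 'k) chart \<Rightarrow> real ^ 'k \<Rightarrow> 'm \<Rightarrow> real ^ 'k" where
  "chart_field A d w p = transition_deriv d (chart_at A p) p w"

lemma const_ext_eq: "const_ext A p v = chart_field A (chart_at A p) v"
  by (simp add: fun_eq_iff const_ext_def chart_field_def transition_deriv_def)

locale atlas =
  fixes A :: "('m::topological_space, 'k::finite) chart set"
  assumes smooth_atlas: "smooth_atlas A"
begin

lemma chart_at: "chart_at A p \<in> A" "p \<in> cdom (chart_at A p)"
proof -
  have "\<exists>c. c \<in> A \<and> p \<in> cdom c"
    using smooth_atlas unfolding smooth_atlas_def by blast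
  then show "chart_at A p \<in> A" "p \<in> cdom (chart_at A p)"
    unfolding chart_at_def by (metis (mono_tags, lifting) someI_ex)+
qed

lemma is_chart: "c \<in> A \<Longrightarrow> is_chart c"
  using smooth_atlas by (simp add: smooth_atlas_def)

lemma open_cdom: "c \<in> A \<Longrightarrow> open (cdom c)"
  using is_chart by (auto simp: is_chart_def)

lemma param_coord: "c \<in> A \<Longrightarrow> p \<in> cdom c \<Longrightarrow> param c (coord c p) = p"
  using is_chart unfolding is_chart_def homeomorphism_def by blast

lemma coord_param: "c \<in> A \<Longrightarrow> x \<in> coord c ` cdom c \<Longrightarrow> coord c (param c x) = x"
  using is_chart unfolding is_chart_def homeomorphism_def by blast

lemma param_in: "c \<in> A \<Longrightarrow> x \<in> coord c ` (cdom c \<inter> V) \<Longrightarrow> param c x \<in> cdom c \<inter> V"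
  using param_coord[of c] by auto

lemma open_coord_image:
  assumes "c \<in> A" "open V"
  shows "open (coord c ` (cdom c \<inter> V))"
proof -
  have h: "homeomorphism (cdom c) (coord c ` cdom c) (coord c) (param c)" "open (coord c ` cdom c)"
    using is_chart[OF assms(1)] by (auto simp: is_chart_def)
  have "openin (top_of_set (coord c ` cdom c)) (coord c ` (cdom c \<inter> V))"
    by (rule homeomorphism_imp_open_map[OF h(1)]) (use assms(2) in auto)
  then show ?thesis
    using h(2) openin_open_trans by blast
qed

lemma open_coord_range: "c \<in> A \<Longrightarrow> open (coord c ` cdom c)"
  using is_chart by (auto simp: is_chart_def)

lemma smooth_transition:
  "c \<in> A \<Longrightarrow> d \<in> A \<Longrightarrow> smooth_on (coord c ` (cdom c \<inter> cdom d)) (coord d \<circ> param c)"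
  using smooth_atlas by (simp add: smooth_atlas_def)

lemma open_transition: "c \<in> A \<Longrightarrow> d \<in> A \<Longrightarrow> open (coord c ` (cdom c \<inter> cdom d))"
  by (simp add: open_coord_image open_cdom)

lemma transition_has_derivative:
  assumes "c \<in> A" "d \<in> A" "p \<in> cdom c" "p \<in> cdom d"
  shows "((coord d \<circ> param c) has_derivative transition_deriv c d p) (at (coord c p))"
  unfolding transition_deriv_def using assms
  by (intro smooth_on_has_derivative[OF open_transition[OF assms(1,2)] smooth_transition[OF assms(1,2)]]) auto

lemma linear_transition_deriv:
  assumes "c \<in> A" "d \<in> A" "p \<in> cdom c" "p \<in> cdom d"
  shows "linear (transition_deriv c d p)"
  using transition_has_derivative[OF assms] has_derivative_linear by blast

lemma transition_deriv_self:
  assumes "c \<in> A" "p \<in> cdom c"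
  shows "transition_deriv c c p = id"
proof -
  have "((coord c \<circ> param c) has_derivative id) (at (coord c p))"
    by (rule has_derivative_transform_within_open[OF has_derivative_id open_coord_range[OF assms(1)]])
       (use assms coord_param in auto)
  then show ?thesis
    using transition_has_derivative[OF assms(1,1,2,2)] has_derivative_unique by blast
qed

text \<open>The chain rule on a triple overlap. It is what makes the arbitrary choice
  \<open>chart_at\<close> drop out of every computation.\<close>

lemma transition_deriv_trans:
  assumes "c \<in> A" "d \<in> A" "e \<in> A" "p \<in> cdom c" "p \<in> cdom d" "p \<in> cdom e"
  shows "transition_deriv d e p (transition_deriv c d p w) = transition_deriv c e p w"
proof -
  have pc: "(coord d \<circ> param c) (coord c p) = coord d p"
    using assms param_coord by simp
  have "((coord e \<circ> param d) \<circ> (coord d \<circ> param c) has_derivative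
     (transition_deriv d e p \<circ> transition_deriv c d p)) (at (coord c p))"
    by (rule diff_chain_at) (use transition_has_derivative assms pc in auto)
  then have "((coord e \<circ> param c) has_derivative
     (transition_deriv d e p \<circ> transition_deriv c d p)) (at (coord c p))"
    by (rule has_derivative_transform_within_open[OF _ open_transition[OF assms(1,2)]])
       (use assms param_coord[of c] param_coord[of d] in auto)
  then have "transition_deriv d e p \<circ> transition_deriv c d p = transition_deriv c e p"
    using transition_has_derivative[of c e p] assms has_derivative_unique by blast
  then show ?thesis by (metis comp_apply)
qed

lemma components_chart_field:
  assumes "c \<in> A" "d \<in> A" "p \<in> cdom c" "p \<in> cdom d"
  shows "components A c p (chart_field A d w p) = transition_deriv d c p w"
  unfolding components_eq chart_field_def using assms chart_at
  by (intro transition_deriv_trans) auto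

text \<open>Makes the preferred chart at \<open>p\<close> convenient for identities at
  \<open>p\<close> itself: components and tangent vector coincide there.\<close>

lemma chart_field_chart_at: "chart_field A (chart_at A p) w p = w"
  unfolding chart_field_def using chart_at transition_deriv_self by simp

lemma linear_chart_field:
  assumes "d \<in> A" "p \<in> cdom d"
  shows "linear (\<lambda>w. chart_field A d w p)"
  unfolding chart_field_def using linear_transition_deriv[OF assms(1) chart_at(1) assms(2) chart_at(2)] .

text \<open>By the cocycle rule the components in a chart \<open>c\<close> form the Jacobian of the
  change from \<open>d\<close> to \<open>c\<close> applied to \<open>w\<close>, with no trace of the
  discontinuous \<open>chart_at\<close>.\<close>

lemma smooth_vf_chart_field:
  assumes d: "d \<in> A"
  shows "smooth_vf A (cdom d) (chart_field A d w)"
  unfolding smooth_vf_def smooth_fun_def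
proof (intro ballI)
  fix c c' assume c: "c \<in> A" "c' \<in> A"
  let ?S = "coord c' ` (cdom c' \<inter> (cdom c \<inter> cdom d))"
  have S: "open ?S"
    using c d by (intro open_coord_image open_Int open_cdom)
  have D: "smooth_on (coord d ` (cdom d \<inter> cdom c)) (\<lambda>y. frechet_derivative (coord c \<circ> param d) (at y) w)"
    by (intro smooth_on_frechet_derivative open_transition smooth_transition c d)
  have "smooth_on ?S ((\<lambda>y. frechet_derivative (coord c \<circ> param d) (at y) w) \<circ> (coord d \<circ> param c'))"
  proof (rule smooth_on_compose[OF S open_transition[OF d c(1)] D])
    show "smooth_on ?S (coord d \<circ> param c')"
      by (rule smooth_on_subset[OF smooth_transition[OF c(2) d]]) auto
  qed (use c param_coord[OF c(2)] in force)
  then show "smooth_on ?S ((\<lambda>p. components A c p (chart_field A d w p)) \<circ> param c')"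
  proof (rule smooth_on_cong[rotated])
    fix x assume "x \<in> ?S"
    then have "param c' x \<in> cdom c" "param c' x \<in> cdom d"
      using param_in[OF c(2), of x "cdom c \<inter> cdom d"] by auto
    then show "((\<lambda>y. frechet_derivative (coord c \<circ> param d) (at y) w) \<circ> (coord d \<circ> param c')) x =
      ((\<lambda>p. components A c p (chart_field A d w p)) \<circ> param c') x"
      using components_chart_field[OF c(1) d] by (simp add: transition_deriv_def)
  qed
qed

section \<open>Velocities and their one-sided limits in a fixed chart\<close>

text \<open>Replaces velocities, which are defined by a chart that changes along the curve, by the
  derivative of one coordinate curve; the difference is a Jacobian supplied by the chain
  rule.\<close>

lemma velocity_chart:
  assumes d: "d \<in> A" and I: "open I" "t \<in> I"
    and \<sigma>: "\<And>u. u \<in> I \<Longrightarrow> \<sigma> u \<in> cdom d" "\<And>u. u \<in> I \<Longrightarrow> coord d (\<sigma> u) = \<kappa> u"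
    and \<kappa>: "(\<kappa> has_vector_derivative \<kappa>') (at t)"
  shows "velocity A \<sigma> t = chart_field A d \<kappa>' (\<sigma> t)"
proof -
  let ?e = "chart_at A (\<sigma> t)"
  have "((coord ?e \<circ> param d) has_derivative transition_deriv d ?e (\<sigma> t)) (at (\<kappa> t))"
    using transition_has_derivative[OF d chart_at(1) \<sigma>(1)[OF I(2)] chart_at(2)] \<sigma>(2)[OF I(2)] by simp
  from vector_derivative_diff_chain_within[OF \<kappa>, of "coord ?e \<circ> param d"] has_derivative_at_withinI[OF this]
  have "((coord ?e \<circ> param d) \<circ> \<kappa> has_vector_derivative transition_deriv d ?e (\<sigma> t) \<kappa>') (at t)"
    by blast
  then have "(coord ?e \<circ> \<sigma> has_vector_derivative transition_deriv d ?e (\<sigma> t) \<kappa>') (at t)"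
    by (rule has_vector_derivative_transform_within_open[OF _ I])
       (metis \<sigma> param_coord[OF d] comp_apply)
  then show ?thesis
    unfolding velocity_def chart_field_def by (rule vector_derivative_at)
qed

text \<open>Serves both one-sided limits, with \<open>S\<close> an open half-line ending at
  \<open>t\<close>. The curve \<kappa> is smooth on both sides of \<open>t\<close> and so has a
  derivative there, but \<sigma> is tied to it only on \<open>S\<close> and at
  \<open>t\<close>.\<close>

lemma tendsto_velocity_components:
  fixes \<kappa> :: "real \<Rightarrow> real ^ 'k"
  assumes d: "d \<in> A" and K: "open K" "t \<in> K" and \<kappa>: "smooth_on K \<kappa>" and S: "open S"
    and \<sigma>: "\<And>u. u \<in> K \<inter> insert t S \<Longrightarrow> \<sigma> u \<in> cdom d" "\<And>u. u \<in> K \<inter> insert t S \<Longrightarrow> coord d (\<sigma> u) = \<kappa> u"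
  shows "((\<lambda>u. components A (chart_at A (\<sigma> t)) (\<sigma> u) (velocity A \<sigma> u)) \<longlongrightarrow>
    chart_field A d (frechet_derivative \<kappa> (at t) 1) (\<sigma> t)) (at t within S)"
proof -
  let ?e = "chart_at A (\<sigma> t)"
  let ?\<Omega> = "coord d ` (cdom d \<inter> cdom ?e)"
  \<comment> \<open>Shrinks \<open>K\<close> so that \<kappa> stays in the overlap with the
    preferred chart of \<sigma> t. Below, \<mu> is \<kappa> in that chart, and continuity of its
    derivative gives the limit.\<close>
  define L where "L = K \<inter> \<kappa> -` ?\<Omega>"
  have \<Omega>: "open ?\<Omega>" "smooth_on ?\<Omega> (coord ?e \<circ> param d)"
    by (intro open_transition smooth_transition d chart_at)+
  have L: "open L"
    unfolding L_def using continuous_open_preimage[OF smooth_on_continuous_on[OF \<kappa>] K(1) \<Omega>(1)] .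
  have t\<kappa>: "\<kappa> t = coord d (\<sigma> t)" and tL: "t \<in> L"
    using \<sigma>[of t] K chart_at(2)[of "\<sigma> t"] unfolding L_def by (auto intro!: image_eqI[of _ _ "\<sigma> t"])
  have \<kappa>L: "smooth_on L \<kappa>"
    using \<kappa> L_def smooth_on_subset by blast
  define \<mu> where "\<mu> = (coord ?e \<circ> param d) \<circ> \<kappa>"
  have sm: "smooth_on L \<mu>"
    unfolding \<mu>_def by (rule smooth_on_compose[OF L \<Omega> \<kappa>L]) (auto simp: L_def)
  have eq: "frechet_derivative \<mu> (at u) 1 =
      frechet_derivative (coord ?e \<circ> param d) (at (\<kappa> u)) (frechet_derivative \<kappa> (at u) 1)" if "u \<in> L" for u
  proof -
    have "(\<kappa> has_derivative frechet_derivative \<kappa> (at u)) (at u)"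
      by (rule smooth_on_has_derivative[OF L \<kappa>L that])
    moreover have "((coord ?e \<circ> param d) has_derivative
        frechet_derivative (coord ?e \<circ> param d) (at (\<kappa> u))) (at (\<kappa> u))"
      by (rule smooth_on_has_derivative[OF \<Omega>]) (use that in \<open>auto simp: L_def\<close>)
    ultimately show ?thesis
      unfolding \<mu>_def
      by (metis comp_apply differentiable_def frechet_derivative_compose)
  qed
  have "continuous_on L (\<lambda>u. frechet_derivative \<mu> (at u) 1)"
    by (rule smooth_on_continuous_on[OF smooth_on_frechet_derivative[OF L sm]])
  then have "isCont (\<lambda>u. frechet_derivative \<mu> (at u) 1) t"
    using tL continuous_on_eq_continuous_at[OF L] by blast
  then have "((\<lambda>u. frechet_derivative \<mu> (at u) 1) \<longlongrightarrow> frechet_derivative \<mu> (at t) 1) (at t within S)"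
    unfolding isCont_def by (rule tendsto_mono[OF at_le[OF subset_UNIV]])
  moreover have "frechet_derivative \<mu> (at t) 1 = chart_field A d (frechet_derivative \<kappa> (at t) 1) (\<sigma> t)"
    unfolding eq[OF tL] chart_field_def transition_deriv_def t\<kappa> ..
  moreover have "\<forall>\<^sub>F u in at t within S.
     frechet_derivative \<mu> (at u) 1 = components A ?e (\<sigma> u) (velocity A \<sigma> u)"
    unfolding eventually_at_topological
  proof (intro exI[of _ L] conjI ballI impI L tL)
    fix u assume u: "u \<in> L" "u \<noteq> t" "u \<in> S"
    have \<kappa>u: "coord d (\<sigma> u) = \<kappa> u" "\<sigma> u \<in> cdom d"
      using \<sigma>[of u] u L_def by auto
    have \<sigma>u: "\<sigma> u \<in> cdom ?e"
      using u(1) \<kappa>u param_coord[OF d] unfolding L_def by (metis (no_types, lifting) IntD2 d param_in vimageE)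
    have "(\<kappa> has_vector_derivative frechet_derivative \<kappa> (at u) 1) (at u)"
      using smooth_on_has_derivative[OF L \<kappa>L u(1)]
      by (metis differentiable_def frechet_derivative_eq_vector_derivative scaleR_one vector_derivative_works)
    \<comment> \<open>For u in \<open>S\<close> the set \<open>L \<inter> S\<close> is an open
      neighbourhood on which \<sigma> is represented by \<kappa>, so the two-sided velocity
      exists.\<close>
    then have "velocity A \<sigma> u = chart_field A d (frechet_derivative \<kappa> (at u) 1) (\<sigma> u)"
      using u \<sigma> by (intro velocity_chart[OF d open_Int[OF L S]]) (auto simp: L_def)
    then show "frechet_derivative \<mu> (at u) 1 = components A ?e (\<sigma> u) (velocity A \<sigma> u)"
      using components_chart_field[OF chart_at(1) d \<sigma>u \<kappa>u(2)] eq[OF u(1)] \<kappa>u(1)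
      by (simp add: transition_deriv_def)
  qed
  ultimately show ?thesis
    using tendsto_cong by fastforce
qed

lemma velocity_right_chart:
  fixes \<kappa> :: "real \<Rightarrow> real ^ 'k"
  assumes "d \<in> A" "open K" "t \<in> K" "smooth_on K \<kappa>"
    and "\<And>u. u \<in> K \<Longrightarrow> t \<le> u \<Longrightarrow> \<sigma> u \<in> cdom d \<and> coord d (\<sigma> u) = \<kappa> u"
  shows "velocity_right A \<sigma> t = chart_field A d (frechet_derivative \<kappa> (at t) 1) (\<sigma> t)"
  unfolding velocity_right_def
  by (rule tendsto_Lim[OF _ tendsto_velocity_components[OF assms(1-4)]]) (use assms in auto)

lemma velocity_left_chart:
  fixes \<kappa> :: "real \<Rightarrow> real ^ 'k"
  assumes "d \<in> A" "open K" "t \<in> K" "smooth_on K \<kappa>"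
    and "\<And>u. u \<in> K \<Longrightarrow> u \<le> t \<Longrightarrow> \<sigma> u \<in> cdom d \<and> coord d (\<sigma> u) = \<kappa> u"
  shows "velocity_left A \<sigma> t = chart_field A d (frechet_derivative \<kappa> (at t) 1) (\<sigma> t)"
  unfolding velocity_left_def
  by (rule tendsto_Lim[OF _ tendsto_velocity_components[OF assms(1-4)]]) (use assms in auto)

text \<open>One coordinate representative around \<open>t\<close> serves both sides. It follows that
  jumps can occur only at break points.\<close>

lemma velocity_left_eq_right:
  assumes "smooth_map_into A {p..q} \<sigma>" "p < t" "t < q"
  shows "velocity_left A \<sigma> t = velocity_right A \<sigma> t"
proof -
  obtain c V where c: "c \<in> A" and V: "open V" "t \<in> V" "\<sigma> ` (V \<inter> {p..q}) \<subseteq> cdom c"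
    and sm: "smooth_on (V \<inter> {p..q}) (coord c \<circ> \<sigma>)"
    using assms unfolding smooth_map_into_def by (metis atLeastAtMost_iff less_imp_le)
  let ?K = "V \<inter> {p<..<q}"
  have K: "open ?K" "t \<in> ?K" using V assms by auto
  have smK: "smooth_on ?K (coord c \<circ> \<sigma>)"
    by (rule smooth_on_subset[OF sm]) auto
  have "velocity_left A \<sigma> t = chart_field A c (frechet_derivative (coord c \<circ> \<sigma>) (at t) 1) (\<sigma> t)"
    by (rule velocity_left_chart[OF c K smK]) (use V(3) in auto)
  also have "\<dots> = velocity_right A \<sigma> t"
    by (rule velocity_right_chart[OF c K smK, symmetric]) (use V(3) in auto)
  finally show ?thesis .
qed

end

section \<open>The first variation in a chart\<close>

text \<open>The coefficients of the metric in the chart \<open>d\<close>, as a bilinear form on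
  components in \<open>d\<close>; \<open>g\<close> itself expects components in the preferred
  chart.\<close>

definition chart_metric ::
  "('m, 'k::finite) chart set \<Rightarrow> ('m \<Rightarrow> real ^ 'k \<Rightarrow> real ^ 'k \<Rightarrow> real) \<Rightarrow> ('m, 'k) chart \<Rightarrow>
   real ^ 'k \<Rightarrow> real ^ 'k \<Rightarrow> real ^ 'k \<Rightarrow> real" where
  "chart_metric A g d x v w =
     g (param d x) (chart_field A d v (param d x)) (chart_field A d w (param d x))"

text \<open>Points of the plane are ordered \<open>(t, s)\<close>, although the family is applied as
  \<open>F s t\<close>.\<close>

abbreviation d_t :: "(real \<times> real \<Rightarrow> 'a::real_normed_vector) \<Rightarrow> real \<times> real \<Rightarrow> 'a" where
  "d_t f z \<equiv> frechet_derivative f (at z) (1, 0)"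

abbreviation d_s :: "(real \<times> real \<Rightarrow> 'a::real_normed_vector) \<Rightarrow> real \<times> real \<Rightarrow> 'a" where
  "d_s f z \<equiv> frechet_derivative f (at z) (0, 1)"

text \<open>\<open>W\<close> is open so that two-sided velocities in both directions exist at each
  of its points; of the strips of a variation only the interior qualifies.\<close>

definition chart_family ::
  "('m, 'k::finite) chart set \<Rightarrow> ('m, 'k) chart \<Rightarrow> (real \<times> real) set \<Rightarrow> (real \<Rightarrow> real \<Rightarrow> 'm) \<Rightarrow>
   (real \<times> real \<Rightarrow> real ^ 'k) \<Rightarrow> bool" where
  "chart_family A d W F f \<longleftrightarrow> d \<in> A \<and> open W \<and> smooth_on W f \<and>
     (\<forall>t s. (t, s) \<in> W \<longrightarrow> F s t \<in> cdom d \<and> coord d (F s t) = f (t, s))"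

lemma open_slice1:
  assumes "open W"
  shows "open {t. (t, s) \<in> W}"
proof -
  have "continuous_on UNIV (\<lambda>t. (t, s))" by (intro continuous_intros)
  from open_vimage[OF assms this] show ?thesis by (simp add: vimage_def)
qed

lemma open_slice2:
  assumes "open W"
  shows "open {s. (t, s) \<in> W}"
proof -
  have "continuous_on UNIV (\<lambda>s. (t, s))" by (intro continuous_intros)
  from open_vimage[OF assms this] show ?thesis by (simp add: vimage_def)
qed

section \<open>Metric and connection in coordinates\<close>

locale metric_connection = atlas A
  for A :: "('m::topological_space, 'k::finite) chart set" +
  fixes g :: "'m \<Rightarrow> real ^ 'k \<Rightarrow> real ^ 'k \<Rightarrow> real"
    and N :: "('m, 'k) connection"
  assumes riemannian: "riemannian_metric A g"
    and parallel: "\<And>U Y Z p v. open U \<Longrightarrow> smooth_vf A U Y \<Longrightarrow> smooth_vf A U Z \<Longrightarrow> p \<in> U \<Longrightarrow>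
      dir_deriv A p v (\<lambda>q. g q (Y q) (Z q)) = g p (N p v Y) (Z p) + g p (Y p) (N p v Z)"
begin

abbreviation gc where "gc \<equiv> chart_metric A g"

lemma bilinear_g: "bilinear (g p)"
  using riemannian by (simp add: riemannian_metric_def)

lemma g_sym: "g p v w = g p w v"
  using riemannian unfolding riemannian_metric_def by blast

lemmas g_simps = bilinear_ladd[OF bilinear_g] bilinear_radd[OF bilinear_g]
  bilinear_lsub[OF bilinear_g] bilinear_rsub[OF bilinear_g]

lemma bilinear_chart_metric:
  assumes "d \<in> A" "x \<in> coord d ` cdom d"
  shows "bilinear (gc d x)"
proof -
  have p: "param d x \<in> cdom d"
    using assms param_coord[OF assms(1)] by auto
  have l: "linear (\<lambda>w. chart_field A d w (param d x))"
    by (rule linear_chart_field[OF assms(1) p])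
  have b: "linear (\<lambda>v. g q v w)" "linear (\<lambda>w. g q v w)" for q v w
    using bilinear_g[of q] by (auto simp: bilinear_def)
  show ?thesis
    unfolding bilinear_def chart_metric_def
    using linear_compose[OF l b(1)] linear_compose[OF l b(2)] by (simp add: o_def)
qed

lemma smooth_chart_metric:
  assumes d: "d \<in> A"
  shows "smooth_on (coord d ` cdom d) (\<lambda>x. gc d x v w)"
proof -
  have "smooth_fun A (cdom d) (\<lambda>p. g p (chart_field A d v p) (chart_field A d w p))"
    using riemannian smooth_vf_chart_field[OF d] open_cdom[OF d]
    unfolding riemannian_metric_def by blast
  then have "smooth_on (coord d ` (cdom d \<inter> cdom d))
     ((\<lambda>p. g p (chart_field A d v p) (chart_field A d w p)) \<circ> param d)"
    unfolding smooth_fun_def using d by blast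
  then show ?thesis
    by (simp add: chart_metric_def o_def)
qed

lemma chart_metric_coord:
  "d \<in> A \<Longrightarrow> p \<in> cdom d \<Longrightarrow> gc d (coord d p) v w = g p (chart_field A d v p) (chart_field A d w p)"
  by (simp add: chart_metric_def param_coord)

text \<open>Parallelism of \<open>g\<close>, applied to two coordinate fields. It expresses
  derivatives of the metric coefficients by covariant derivatives of coordinate fields, which play
  the part of Christoffel symbols.\<close>

lemma chart_metric_deriv:
  "frechet_derivative (\<lambda>x. gc (chart_at A p) x v w) (at (coord (chart_at A p) p)) u =
     g p (N p u (const_ext A p v)) w + g p v (N p u (const_ext A p w))"
proof -
  let ?d = "chart_at A p"
  have "dir_deriv A p u (\<lambda>q. g q (chart_field A ?d v q) (chart_field A ?d w q)) =
    g p (N p u (chart_field A ?d v)) (chart_field A ?d w p) + g p (chart_field A ?d v p) (N p u (chart_field A ?d w))"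
    by (rule parallel[OF open_cdom[OF chart_at(1)] smooth_vf_chart_field[OF chart_at(1)]
          smooth_vf_chart_field[OF chart_at(1)] chart_at(2)])
  then show ?thesis
    by (simp add: dir_deriv_def o_def chart_metric_def[abs_def] const_ext_eq chart_field_chart_at)
qed

text \<open>Coordinate fields commute: in the preferred chart at \<open>p\<close> their components
  are constant, so both derivatives in the bracket vanish.\<close>

lemma lie_bracket_const_ext: "lie_bracket A (const_ext A p v) (const_ext A p w) p = 0"
proof -
  let ?d = "chart_at A p"
  have "dir_deriv A p u (\<lambda>q. components A ?d q (const_ext A p w q)) = 0" for u w
  proof -
    have "((\<lambda>q. components A ?d q (const_ext A p w q)) \<circ> param ?d has_derivative (\<lambda>h. 0)) (at (coord ?d p))"
    proof (rule has_derivative_transform_within_open[OF has_derivative_const open_coord_range[OF chart_at(1)]])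
      show "coord ?d p \<in> coord ?d ` cdom ?d" using chart_at by blast
      fix x assume "x \<in> coord ?d ` cdom ?d"
      then have "param ?d x \<in> cdom ?d"
        using param_coord[OF chart_at(1)] by auto
      then show "w = ((\<lambda>q. components A ?d q (const_ext A p w q)) \<circ> param ?d) x"
        by (simp add: const_ext_eq components_chart_field chart_at transition_deriv_self)
    qed
    then show ?thesis
      unfolding dir_deriv_def by (rule fun_cong[OF frechet_derivative_at[symmetric]])
  qed
  then show ?thesis by (simp add: lie_bracket_def)
qed

lemma torsion_eq: "torsion A N p v w = N p v (const_ext A p w) - N p w (const_ext A p v)"
  by (simp add: torsion_def lie_bracket_const_ext Let_def)

text \<open>The full square of the speed, without the customary 1/2; this is why halves of its
  s-derivative appear below.\<close>

definition energy_density where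
  "energy_density d f z = gc d (f z) (d_t f z) (d_t f z)"

definition pairing where
  "pairing d f z = gc d (f z) (d_s f z) (d_t f z)"

context
  fixes d W F f
  assumes cf: "chart_family A d W F f"
begin

lemma chart_familyD:
  "d \<in> A" "open W" "smooth_on W f"
  "(t, s) \<in> W \<Longrightarrow> F s t \<in> cdom d" "(t, s) \<in> W \<Longrightarrow> coord d (F s t) = f (t, s)"
  using cf by (auto simp: chart_family_def)

lemma chart_family_image: "f ` W \<subseteq> coord d ` cdom d"
  using cf unfolding chart_family_def by force

lemma chart_family_has_derivative: "z \<in> W \<Longrightarrow> (f has_derivative frechet_derivative f (at z)) (at z)"
  by (rule smooth_on_has_derivative[OF chart_familyD(2,3)])

lemma smooth_partials: "smooth_on W (\<lambda>z. frechet_derivative f (at z) h)"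
  by (rule smooth_on_frechet_derivative[OF chart_familyD(2,3)])

lemma velocity_t:
  assumes "(t, s) \<in> W"
  shows "velocity A (F s) t = chart_field A d (d_t f (t, s)) (F s t)"
proof (rule velocity_chart[OF chart_familyD(1)])
  show "open {t. (t, s) \<in> W}"
    by (rule open_slice1[OF chart_familyD(2)])
  show "((\<lambda>t. f (t, s)) has_vector_derivative d_t f (t, s)) (at t)"
    by (rule has_vector_derivative_slice1[OF chart_family_has_derivative[OF assms]])
qed (use assms chart_familyD in auto)

lemma velocity_s:
  assumes "(t, s) \<in> W"
  shows "velocity A (\<lambda>s. F s t) s = chart_field A d (d_s f (t, s)) (F s t)"
proof (rule velocity_chart[OF chart_familyD(1)])
  show "open {s. (t, s) \<in> W}"
    by (rule open_slice2[OF chart_familyD(2)])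
  show "((\<lambda>s. f (t, s)) has_vector_derivative d_s f (t, s)) (at s)"
    by (rule has_vector_derivative_slice2[OF chart_family_has_derivative[OF assms]])
qed (use assms chart_familyD in auto)

lemma energy_density_eq:
  assumes "(t, s) \<in> W"
  shows "energy_density d f (t, s) = g (F s t) (velocity A (F s) t) (velocity A (F s) t)"
  unfolding energy_density_def chart_familyD(5)[OF assms, symmetric] velocity_t[OF assms]
  by (rule chart_metric_coord[OF chart_familyD(1) chart_familyD(4)[OF assms]])

lemma pairing_eq:
  assumes "(t, s) \<in> W"
  shows "pairing d f (t, s) = g (F s t) (velocity A (\<lambda>s. F s t) s) (velocity A (F s) t)"
  unfolding pairing_def chart_familyD(5)[OF assms, symmetric] velocity_t[OF assms] velocity_s[OF assms]
  by (rule chart_metric_coord[OF chart_familyD(1) chart_familyD(4)[OF assms]])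

lemma smooth_energy_density: "smooth_on W (energy_density d f)"
  unfolding energy_density_def
  by (rule smooth_on_bilinear_family[OF open_coord_range[OF chart_familyD(1)] bilinear_chart_metric[OF chart_familyD(1)]
      smooth_chart_metric[OF chart_familyD(1)] chart_familyD(2,3) smooth_partials smooth_partials chart_family_image])

lemma smooth_pairing: "smooth_on W (pairing d f)"
  unfolding pairing_def
  by (rule smooth_on_bilinear_family[OF open_coord_range[OF chart_familyD(1)] bilinear_chart_metric[OF chart_familyD(1)]
      smooth_chart_metric[OF chart_familyD(1)] chart_familyD(2,3) smooth_partials smooth_partials chart_family_image])

text \<open>Allows the passage to the preferred chart of a given point, at the price of a smaller
  parameter domain.\<close>

lemma chart_family_change:
  assumes e: "e \<in> A"
  shows "chart_family A e (W \<inter> f -` (coord d ` (cdom d \<inter> cdom e))) F ((coord e \<circ> param d) \<circ> f)"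
proof -
  let ?\<Omega> = "coord d ` (cdom d \<inter> cdom e)"
  let ?W = "W \<inter> f -` ?\<Omega>"
  have \<Omega>: "open ?\<Omega>" "smooth_on ?\<Omega> (coord e \<circ> param d)"
    by (intro open_transition smooth_transition chart_familyD(1) e)+
  have W: "open ?W"
    using continuous_open_preimage[OF smooth_on_continuous_on[OF chart_familyD(3)] chart_familyD(2) \<Omega>(1)] .
  have "smooth_on ?W ((coord e \<circ> param d) \<circ> f)"
    by (rule smooth_on_compose[OF W \<Omega> smooth_on_subset[OF chart_familyD(3)]]) auto
  moreover have "F s t \<in> cdom e \<and> coord e (F s t) = ((coord e \<circ> param d) \<circ> f) (t, s)" if "(t, s) \<in> ?W" for t s
  proof -
    have 1: "F s t = param d (f (t, s))"
      using that chart_familyD(4,5)[of t s] param_coord[OF chart_familyD(1), of "F s t"] by simp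
    have "param d (f (t, s)) \<in> cdom e"
      using param_in[OF chart_familyD(1), of "f (t, s)" "cdom e"] that by auto
    then show ?thesis by (simp add: 1)
  qed
  ultimately show ?thesis
    unfolding chart_family_def using e W by blast
qed

end

text \<open>In the preferred chart at the point, components are the vectors themselves. Both
  derivatives then follow from the product rule, with \<open>chart_metric_deriv\<close> for the
  metric coefficients.\<close>

lemma first_variation_chart_at:
  assumes cf: "chart_family A (chart_at A (F 0 t)) W F f" and z: "(t, 0) \<in> W"
    and \<gamma>: "\<And>u. (u, 0) \<in> W \<Longrightarrow> F 0 u = \<gamma> u" "\<And>u. (u, 0) \<in> W \<Longrightarrow> velocity A (F 0) u = velocity A \<gamma> u"
  shows "d_t (pairing (chart_at A (F 0 t)) f) (t, 0) - d_s (energy_density (chart_at A (F 0 t)) f) (t, 0) / 2 =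
    g (\<gamma> t) (velocity A (\<lambda>s. F s t) 0) (cov_deriv_along A N \<gamma> (velocity A \<gamma>) t)
    - g (\<gamma> t) (torsion A N (\<gamma> t) (velocity A (\<lambda>s. F s t) 0) (velocity A \<gamma> t)) (velocity A \<gamma> t)"
proof -
  define p where "p = F 0 t"
  define d where "d = chart_at A p"
  note cf' = cf[folded p_def, folded d_def]
  note D = chart_familyD[OF cf']
  have fd: "frechet_derivative (\<lambda>z. gc d (f z) (frechet_derivative f (at z) h1) (frechet_derivative f (at z) h2))
      (at (t, 0)) h =
    frechet_derivative (\<lambda>y. gc d y (frechet_derivative f (at (t, 0)) h1) (frechet_derivative f (at (t, 0)) h2))
      (at (f (t, 0))) (frechet_derivative f (at (t, 0)) h)
    + gc d (f (t, 0)) (frechet_derivative (\<lambda>z. frechet_derivative f (at z) h1) (at (t, 0)) h)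
        (frechet_derivative f (at (t, 0)) h2)
    + gc d (f (t, 0)) (frechet_derivative f (at (t, 0)) h1)
        (frechet_derivative (\<lambda>z. frechet_derivative f (at z) h2) (at (t, 0)) h)" for h h1 h2
    by (rule frechet_derivative_bilinear_family[OF open_coord_range[OF D(1)] bilinear_chart_metric[OF D(1)]
      smooth_chart_metric[OF D(1)] D(2,3) smooth_partials[OF cf'] smooth_partials[OF cf'] chart_family_image[OF cf'] z])
  have p: "\<gamma> t = p" using \<gamma> z p_def by metis
  have fz: "f (t, 0) = coord d p" using D(5)[OF z] by (simp add: p_def)
  have gc: "gc d (f (t, 0)) v w = g p v w" for v w
    unfolding fz d_def by (simp add: chart_metric_coord chart_at chart_field_chart_at)
  define v where "v = d_t f (t, 0)"
  define x where "x = d_s f (t, 0)"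
  define v' where "v' = d_t (d_t f) (t, 0)"
  define x' where "x' = d_t (d_s f) (t, 0)"
  have vel: "velocity A \<gamma> t = v" "velocity A (\<lambda>s. F s t) 0 = x"
    using velocity_t[OF cf' z] velocity_s[OF cf' z] \<gamma>(2)[OF z]
    by (simp_all add: v_def x_def d_def p_def chart_field_chart_at)
  have mixed: "d_s (d_t f) (t, 0) = x'"
    unfolding x'_def by (rule mixed_partials[OF D(2,3) z, symmetric])
  have pair: "d_t (pairing d f) (t, 0) =
      g p (N p v (const_ext A p x)) v + g p x (N p v (const_ext A p v)) + g p x' v + g p x v'"
    unfolding pairing_def fd gc v_def[symmetric] x_def[symmetric] x'_def[symmetric] v'_def[symmetric]
    unfolding fz d_def chart_metric_deriv ..
  have en: "d_s (energy_density d f) (t, 0) =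
      g p (N p x (const_ext A p v)) v + g p v (N p x (const_ext A p v)) + g p x' v + g p v x'"
    unfolding energy_density_def fd gc v_def[symmetric] x_def[symmetric] mixed
    unfolding fz d_def chart_metric_deriv ..
  have "((\<lambda>u. components A d (\<gamma> u) (velocity A \<gamma> u)) has_vector_derivative v') (at t)"
  proof (rule has_vector_derivative_transform_within_open)
    show "((\<lambda>u. d_t f (u, 0)) has_vector_derivative v') (at t)"
      unfolding v'_def
      by (rule has_vector_derivative_slice1[OF smooth_on_has_derivative[OF D(2) smooth_partials[OF cf'] z]])
    show "open {u. (u, 0) \<in> W}"
      by (rule open_slice1[OF D(2)])
    show "t \<in> {u. (u, 0) \<in> W}" using z by simp
    fix u assume "u \<in> {u. (u, 0) \<in> W}"
    then have u: "(u, 0) \<in> W" by simp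
    show "d_t f (u, 0) = components A d (\<gamma> u) (velocity A \<gamma> u)"
      unfolding \<gamma>(1)[OF u, symmetric] \<gamma>(2)[OF u, symmetric] velocity_t[OF cf' u]
      by (simp add: components_chart_field D(1) D(4)[OF u] transition_deriv_self)
  qed
  then have cov: "cov_deriv_along A N \<gamma> (velocity A \<gamma>) t = v' + N p v (const_ext A p v)"
    unfolding cov_deriv_along_def p d_def[symmetric] vel by (simp add: vector_derivative_at)
  \<comment> \<open>By symmetry of \<open>g\<close>, half the energy derivative is g(x', v) plus one
    connection term. The g(x', v) cancels against \<open>pair\<close>, v' joins N v v to form the
    covariant acceleration, and the two remaining connection terms form minus the torsion of (x,
    v).\<close>
  show ?thesis
    unfolding p_def[symmetric] d_def[symmetric] pair en p vel cov torsion_eq g_simps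
    using g_sym[of p v x'] g_sym[of p v "N p x (const_ext A p v)"] by (simp add: field_simps)
qed

text \<open>By \<open>energy_density_eq\<close> and \<open>pairing_eq\<close> both densities depend
  only on \<open>g\<close> and the velocities. They therefore agree near the point in
  \<open>d\<close> and in the preferred chart, and so do their derivatives.\<close>

lemma first_variation_pointwise:
  assumes cf: "chart_family A d W F f" and z: "(t, 0) \<in> W"
    and \<gamma>: "\<And>u. (u, 0) \<in> W \<Longrightarrow> F 0 u = \<gamma> u" "\<And>u. (u, 0) \<in> W \<Longrightarrow> velocity A (F 0) u = velocity A \<gamma> u"
  shows "d_t (pairing d f) (t, 0) - d_s (energy_density d f) (t, 0) / 2 =
    g (\<gamma> t) (velocity A (\<lambda>s. F s t) 0) (cov_deriv_along A N \<gamma> (velocity A \<gamma>) t)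
    - g (\<gamma> t) (torsion A N (\<gamma> t) (velocity A (\<lambda>s. F s t) 0) (velocity A \<gamma> t)) (velocity A \<gamma> t)"
proof -
  let ?e = "chart_at A (F 0 t)"
  define W' where "W' = W \<inter> f -` (coord d ` (cdom d \<inter> cdom ?e))"
  define f' where "f' = (coord ?e \<circ> param d) \<circ> f"
  note D = chart_familyD[OF cf]
  have cf': "chart_family A ?e W' F f'"
    unfolding W'_def f'_def by (rule chart_family_change[OF cf chart_at(1)])
  have z': "(t, 0) \<in> W'"
    using z D(4,5)[OF z] chart_at(2)[of "F 0 t"] unfolding W'_def
    by (auto intro!: image_eqI[of _ _ "F 0 t"])
  have WW: "W' \<subseteq> W" by (auto simp: W'_def)
  have eq: "energy_density ?e f' z = energy_density d f z" "pairing ?e f' z = pairing d f z" if "z \<in> W'" for z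
    using that energy_density_eq[OF cf', of "fst z" "snd z"] energy_density_eq[OF cf, of "fst z" "snd z"]
      pairing_eq[OF cf', of "fst z" "snd z"] pairing_eq[OF cf, of "fst z" "snd z"] WW by auto
  have "frechet_derivative (energy_density ?e f') (at (t, 0)) = frechet_derivative (energy_density d f) (at (t, 0))"
    by (rule frechet_derivative_transform_within_open[OF differentiableI[OF
          smooth_on_has_derivative[OF chart_familyD(2)[OF cf'] smooth_energy_density[OF cf'] z']]
          chart_familyD(2)[OF cf'] z' eq(1)])
  moreover have "frechet_derivative (pairing ?e f') (at (t, 0)) = frechet_derivative (pairing d f) (at (t, 0))"
    by (rule frechet_derivative_transform_within_open[OF differentiableI[OF
          smooth_on_has_derivative[OF chart_familyD(2)[OF cf'] smooth_pairing[OF cf'] z']]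
          chart_familyD(2)[OF cf'] z' eq(2)])
  moreover note first_variation_chart_at[where F=F and t=t and \<gamma>=\<gamma>, OF cf' z' \<gamma>]
  ultimately show ?thesis
    using WW by auto
qed

section \<open>The first variation formula on an interval\<close>

definition speed where
  "speed F s t = tangent_norm g (F s t) (velocity A (F s) t)"

definition variation_integrand where
  "variation_integrand \<gamma> X t = g (\<gamma> t) (X t) (cov_deriv_along A N \<gamma> (velocity A \<gamma>) t)
     - g (\<gamma> t) (torsion A N (\<gamma> t) (X t) (velocity A \<gamma> t)) (velocity A \<gamma> t)"

text \<open>Integrability is part of the claim, since integrals over adjacent intervals are added
  under that condition only; for the speed, small \<open>s\<close> suffices because the derivative
  is taken at 0. The boundary term \<open>B\<close> is a parameter so that it can accumulate
  jumps.\<close>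

definition first_variation where
  "first_variation r F \<gamma> X p q B \<longleftrightarrow>
     (\<exists>\<eta>>0. \<forall>s. \<bar>s\<bar> < \<eta> \<longrightarrow> speed F s integrable_on {p..q}) \<and>
     variation_integrand \<gamma> X integrable_on {p..q} \<and>
     ((\<lambda>s. integral {p..q} (speed F s)) has_real_derivative
        1 / r * (B - integral {p..q} (variation_integrand \<gamma> X))) (at 0)"

lemma first_variation_combine:
  assumes pm: "first_variation r F \<gamma> X p m B" and mq: "first_variation r F \<gamma> X m q B'"
    and le: "p \<le> m" "m \<le> q"
  shows "first_variation r F \<gamma> X p q (B + B')"
proof -
  obtain \<eta> where \<eta>: "\<eta> > 0" "\<And>s. \<bar>s\<bar> < \<eta> \<Longrightarrow> speed F s integrable_on {p..m}"
    using pm unfolding first_variation_def by auto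
  obtain \<eta>' where \<eta>': "\<eta>' > 0" "\<And>s. \<bar>s\<bar> < \<eta>' \<Longrightarrow> speed F s integrable_on {m..q}"
    using mq unfolding first_variation_def by auto
  define \<epsilon> where "\<epsilon> = min \<eta> \<eta>'"
  have int: "speed F s integrable_on {p..q}" if "\<bar>s\<bar> < \<epsilon>" for s
    by (intro Henstock_Kurzweil_Integration.integrable_combine[OF le] \<eta>(2) \<eta>'(2)) (use that in \<open>auto simp: \<epsilon>_def\<close>)
  have I: "variation_integrand \<gamma> X integrable_on {p..q}"
    using pm mq by (intro Henstock_Kurzweil_Integration.integrable_combine[OF le]) (auto simp: first_variation_def)
  have "((\<lambda>s. integral {p..m} (speed F s) + integral {m..q} (speed F s)) has_real_derivative
      1 / r * (B - integral {p..m} (variation_integrand \<gamma> X)) +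
      1 / r * (B' - integral {m..q} (variation_integrand \<gamma> X))) (at 0)"
    using pm mq unfolding first_variation_def by (intro DERIV_add) auto
  then have "((\<lambda>s. integral {p..q} (speed F s)) has_real_derivative
      1 / r * (B - integral {p..m} (variation_integrand \<gamma> X)) +
      1 / r * (B' - integral {m..q} (variation_integrand \<gamma> X))) (at 0)"
    by (rule has_field_derivative_transform_within_open[where S="{-\<epsilon><..<\<epsilon>}"])
       (use \<eta>(1) \<eta>'(1) in \<open>auto simp: \<epsilon>_def intro!: Henstock_Kurzweil_Integration.integral_combine[OF le] int\<close>)
  moreover have "1 / r * (B - integral {p..m} (variation_integrand \<gamma> X)) +
      1 / r * (B' - integral {m..q} (variation_integrand \<gamma> X)) =
      1 / r * (B + B' - integral {p..q} (variation_integrand \<gamma> X))"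
    unfolding Henstock_Kurzweil_Integration.integral_combine[OF le I, symmetric]
    by (simp add: algebra_simps add_divide_distrib)
  ultimately show ?thesis
    unfolding first_variation_def using I int \<eta>(1) \<eta>'(1)
    by (auto intro!: exI[of _ \<epsilon>] simp: \<epsilon>_def)
qed

lemma first_variation_in_chart:
  assumes d: "d \<in> A" and pq: "p < q" and \<delta>: "\<delta> > 0" and r: "r > 0"
    and U: "open U" "smooth_on U f" "{p..q} \<times> {-\<delta><..<\<delta>} \<subseteq> U"
    and F: "\<And>t s. t \<in> {p..q} \<Longrightarrow> \<bar>s\<bar> < \<delta> \<Longrightarrow> F s t \<in> cdom d \<and> coord d (F s t) = f (t, s)"
    and \<gamma>: "\<And>t. t \<in> {p..q} \<Longrightarrow> F 0 t = \<gamma> t"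
    and X: "\<And>t. t \<in> {p..q} \<Longrightarrow> velocity A (\<lambda>s. F s t) 0 = X t"
    and speed: "\<And>t. t \<in> {p<..<q} \<Longrightarrow> tangent_norm g (\<gamma> t) (velocity A \<gamma> t) = r"
  shows "first_variation r F \<gamma> X p q
    (g (\<gamma> q) (X q) (velocity_left A \<gamma> q) - g (\<gamma> p) (X p) (velocity_right A \<gamma> p))"
proof -
  define \<Omega> where "\<Omega> = coord d ` cdom d"
  \<comment> \<open>Off the strip \<open>f\<close> is merely an extension and may leave the
    coordinate range, where the metric coefficients mean nothing.\<close>
  define V where "V = U \<inter> f -` \<Omega>"
  have \<Omega>: "open \<Omega>" unfolding \<Omega>_def by (rule open_coord_range[OF d])
  have V: "open V" unfolding V_def
    by (rule continuous_open_preimage[OF smooth_on_continuous_on[OF U(2)] U(1) \<Omega>])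
  have fV: "smooth_on V f" "f ` V \<subseteq> \<Omega>"
    using smooth_on_subset[OF U(2)] by (auto simp: V_def)
  have inV: "(t, s) \<in> V" if "t \<in> {p..q}" "\<bar>s\<bar> < \<delta>" for t s
  proof -
    have "(t, s) \<in> U" using U(3) that by (auto simp: abs_less_iff subset_iff)
    moreover have "f (t, s) \<in> \<Omega>" using F[OF that] unfolding \<Omega>_def by (metis imageI)
    ultimately show ?thesis by (simp add: V_def)
  qed
  have partial: "smooth_on V (\<lambda>z. frechet_derivative f (at z) h)" for h
    by (rule smooth_on_frechet_derivative[OF V fV(1)])
  define E where "E = energy_density d f"
  define H where "H = pairing d f"
  have sm: "smooth_on V E" "smooth_on V H"
    unfolding E_def H_def energy_density_def pairing_def
    by (rule smooth_on_bilinear_family[OF \<Omega> _ _ V fV(1) partial partial fV(2)];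
        simp add: bilinear_chart_metric smooth_chart_metric d \<Omega>_def)+
  \<comment> \<open>Interior of the strip in \<open>t\<close>: at p and q the two-sided velocity is
    not controlled by \<open>f\<close>.\<close>
  define W where "W = {p<..<q} \<times> {-\<delta><..<\<delta>}"
  have WV: "W \<subseteq> V" using inV by (auto simp: W_def)
  have cf: "chart_family A d W F f"
    unfolding chart_family_def using d F smooth_on_subset[OF fV(1) WV]
    by (auto simp: W_def open_Times)
  have vel0: "velocity A (F 0) t = velocity A \<gamma> t" if "t \<in> {p<..<q}" for t
  proof -
    have "((\<lambda>t. f (t, 0)) has_vector_derivative d_t f (t, 0)) (at t)"
      by (rule has_vector_derivative_slice1[OF smooth_on_has_derivative[OF V fV(1)]])
         (use inV that \<delta> in auto)
    then have "velocity A \<gamma> t = chart_field A d (d_t f (t, 0)) (\<gamma> t)"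
      by (rule velocity_chart[OF d, of "{p<..<q}", rotated -1]) (use that F[of _ 0] \<gamma> \<delta> in auto)
    then show ?thesis
      using velocity_t[OF cf, of t 0] that \<gamma>[of t] \<delta> by (simp add: W_def)
  qed
  have speed_eq: "speed F s t = sqrt (E (t, s))" if "t \<in> {p<..<q}" "\<bar>s\<bar> < \<delta>" for t s
    using energy_density_eq[OF cf, of t s] that
    by (simp add: speed_def tangent_norm_def E_def W_def abs_less_iff)
  \<comment> \<open>The speed is prescribed only inside the interval; continuity of \<open>E\<close>
    carries the value to p and q.\<close>
  have E0: "E (t, 0) = r\<^sup>2" if "t \<in> {p..q}" for t
  proof (rule continuous_constant_on_closure[where S="{p<..<q}" and f="\<lambda>t. E (t, 0)"])
    show "continuous_on (closure {p<..<q}) (\<lambda>t. E (t, 0))"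
      by (rule continuous_on_compose2[OF smooth_on_continuous_on[OF sm(1)]])
         (use pq inV \<delta> in \<open>auto intro!: continuous_intros\<close>)
    show "E (t, 0) = r\<^sup>2" if t: "t \<in> {p<..<q}" for t
    proof -
      have "sqrt (E (t, 0)) = r"
        using speed_eq[OF t, of 0] speed[OF t] vel0[OF t] \<gamma>[of t] t \<delta> by (simp add: speed_def)
      then show ?thesis using r by (metis real_sqrt_gt_0_iff real_sqrt_pow2 less_imp_le)
    qed
    show "t \<in> closure {p<..<q}" using that pq by simp
  qed
  \<comment> \<open>The square root must stay away from 0. Compactness of [p, q] gives one bound
    \<eta> valid for all t; the swap is there because the tube lemma has the compact factor
    second.\<close>
  define V1 where "V1 = V \<inter> E -` {0<..}"
  have V1: "open V1"
    unfolding V1_def by (rule continuous_open_preimage[OF smooth_on_continuous_on[OF sm(1)] V]) simp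
  have "open (prod.swap -` V1)"
    by (intro open_vimage V1 continuous_on_swap)
  moreover have "{0} \<times> {p..q} \<subseteq> prod.swap -` V1"
    using inV E0 r \<delta> by (auto simp: V1_def)
  ultimately obtain S0 where S0: "0 \<in> S0" "open S0" "S0 \<times> {p..q} \<subseteq> prod.swap -` V1"
    using Elementary_Topology.tube_lemma[of "{p..q}" "prod.swap -` V1" 0] by auto
  obtain \<eta>0 where \<eta>0: "\<eta>0 > 0" "ball 0 \<eta>0 \<subseteq> S0"
    using S0 openE by blast
  define \<eta> where "\<eta> = min \<eta>0 \<delta>"
  have \<eta>: "\<eta> > 0" "\<eta> \<le> \<delta>" using \<eta>0 \<delta> by (auto simp: \<eta>_def)
  define I where "I = {-\<eta><..<\<eta>}"
  have in1: "(t, s) \<in> V" "E (t, s) > 0" if "t \<in> {p..q}" "s \<in> I" for t s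
  proof -
    have "s \<in> S0" using that \<eta>0(2) by (auto simp: I_def \<eta>_def dist_real_def)
    then have "(s, t) \<in> prod.swap -` V1" using S0(3) that by blast
    then have "(t, s) \<in> V1" by simp
    then show "(t, s) \<in> V" "E (t, s) > 0" by (auto simp: V1_def)
  qed
  have contE: "continuous_on V (d_s E)" "continuous_on V E"
    using smooth_on_continuous_on[OF smooth_on_frechet_derivative[OF V sm(1)]]
      smooth_on_continuous_on[OF sm(1)] by auto
  have swap: "continuous_on (I \<times> {p..q}) (\<lambda>x. \<phi> (snd x, fst x))"
    if "continuous_on V \<phi>" for \<phi> :: "real \<times> real \<Rightarrow> real"
    by (rule continuous_on_compose2[OF that]) (use in1 in \<open>auto intro!: continuous_intros\<close>)
  have slice: "continuous_on {p..q} (\<lambda>t. \<phi> (t, s))"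
    if "continuous_on V \<phi>" "s \<in> I" for \<phi> :: "real \<times> real \<Rightarrow> real" and s
    by (rule continuous_on_compose2[OF that(1)]) (use in1 that in \<open>auto intro!: continuous_intros\<close>)
  have zI: "0 \<in> I" using \<eta> by (simp add: I_def)
  have int_sqrt: "(\<lambda>t. sqrt (E (t, s))) integrable_on {p..q}" if "s \<in> I" for s
    by (intro integrable_continuous_real continuous_on_real_sqrt slice contE that)
  have "((\<lambda>s. integral (cbox p q) (\<lambda>t. sqrt (E (t, s)))) has_field_derivative
     integral (cbox p q) (\<lambda>t. d_s E (t, 0) / (2 * sqrt (E (t, 0))))) (at 0 within I)"
  proof (rule leibniz_rule_field_derivative[where fx="\<lambda>s t. d_s E (t, s) / (2 * sqrt (E (t, s)))"])
    show "((\<lambda>s. sqrt (E (t, s))) has_real_derivative d_s E (t, s) / (2 * sqrt (E (t, s)))) (at s within I)"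
      if "s \<in> I" "t \<in> cbox p q" for s t
    proof -
      have "((\<lambda>s. E (t, s)) has_real_derivative d_s E (t, s)) (at s)"
        unfolding has_real_derivative_iff_has_vector_derivative
        by (rule has_vector_derivative_slice2[OF smooth_on_has_derivative[OF V sm(1)]])
           (use in1 that in auto)
      moreover have "E (t, s) > 0" using in1 that by auto
      ultimately have "((\<lambda>s. sqrt (E (t, s))) has_real_derivative d_s E (t, s) / (2 * sqrt (E (t, s)))) (at s)"
        by (auto intro!: derivative_eq_intros simp: field_simps)
      then show ?thesis by (rule has_field_derivative_at_within)
    qed
    show "(\<lambda>t. sqrt (E (t, s))) integrable_on cbox p q" if "s \<in> I" for s
      using int_sqrt[OF that] by simp
    have "continuous_on (I \<times> {p..q}) (\<lambda>x. d_s E (snd x, fst x) / (2 * sqrt (E (snd x, fst x))))"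
      by (intro continuous_on_divide continuous_on_mult continuous_on_const continuous_on_real_sqrt swap contE)
         (use in1 in force)
    then show "continuous_on (I \<times> cbox p q) (\<lambda>(s, t). d_s E (t, s) / (2 * sqrt (E (t, s))))"
      by (simp add: split_beta)
  qed (use zI I_def in auto)
  \<comment> \<open>Constant speed enters: sqrt E equals r along the base curve.\<close>
  moreover have "integral {p..q} (\<lambda>t. d_s E (t, 0) / (2 * sqrt (E (t, 0)))) =
      integral {p..q} (\<lambda>t. 1 / r * (d_s E (t, 0) / 2))"
    by (rule Henstock_Kurzweil_Integration.integral_cong) (use E0 r in \<open>simp add: real_sqrt_abs\<close>)
  ultimately have deriv: "((\<lambda>s. integral {p..q} (\<lambda>t. sqrt (E (t, s)))) has_real_derivative
     1 / r * integral {p..q} (\<lambda>t. d_s E (t, 0) / 2)) (at 0)"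
    using at_within_open[OF zI] by (simp add: I_def)
  \<comment> \<open>At p and q \<open>speed\<close> may take arbitrary values, which the integral
    does not see.\<close>
  have int_speed: "(speed F s has_integral integral {p..q} (\<lambda>t. sqrt (E (t, s)))) {p..q}" if "s \<in> I" for s
    by (rule has_integral_spike_interior[where f="\<lambda>t. sqrt (E (t, s))", of _ p q, unfolded cbox_interval])
       (use integrable_integral[OF int_sqrt[OF that]] speed_eq that \<eta> in \<open>auto simp: I_def abs_less_iff\<close>)
  have deriv_speed: "((\<lambda>s. integral {p..q} (speed F s)) has_real_derivative
     1 / r * integral {p..q} (\<lambda>t. d_s E (t, 0) / 2)) (at 0)"
    by (rule has_field_derivative_transform_within_open[OF deriv, where S=I])
       (use zI integral_unique[OF int_speed] in \<open>auto simp: I_def\<close>)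
  have "((\<lambda>t. d_t H (t, 0)) has_integral (H (q, 0) - H (p, 0))) {p..q}"
  proof (rule fundamental_theorem_of_calculus_interior)
    show "continuous_on {p..q} (\<lambda>t. H (t, 0))"
      by (rule slice[OF smooth_on_continuous_on[OF sm(2)] zI])
    show "((\<lambda>t. H (t, 0)) has_vector_derivative d_t H (t, 0)) (at t)" if "t \<in> {p<..<q}" for t
      by (rule has_vector_derivative_slice1[OF smooth_on_has_derivative[OF V sm(2)]])
         (use in1 zI that in auto)
  qed (use pq in simp)
  moreover have int_E: "(\<lambda>t. d_s E (t, 0) / 2) integrable_on {p..q}"
    by (intro integrable_continuous_real continuous_on_divide continuous_on_const slice[OF contE(1) zI]) simp
  ultimately have "((\<lambda>t. d_t H (t, 0) - d_s E (t, 0) / 2) has_integral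
      (H (q, 0) - H (p, 0) - integral {p..q} (\<lambda>t. d_s E (t, 0) / 2))) {p..q}"
    by (intro has_integral_diff integrable_integral)
  \<comment> \<open>Integrability of the integrand comes for free: inside (p, q) it equals a
    difference of two integrable functions.\<close>
  then have int_I: "(variation_integrand \<gamma> X has_integral
      (H (q, 0) - H (p, 0) - integral {p..q} (\<lambda>t. d_s E (t, 0) / 2))) {p..q}"
  proof (rule has_integral_spike_interior[of _ _ p q, unfolded cbox_interval])
    fix t assume "t \<in> box p q"
    then have t: "t \<in> {p<..<q}" by simp
    show "variation_integrand \<gamma> X t = d_t H (t, 0) - d_s E (t, 0) / 2"
      unfolding H_def E_def variation_integrand_def
      using first_variation_pointwise[OF cf, of t \<gamma>] X[of t] t \<gamma> vel0 \<delta> by (simp add: W_def)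
  qed
  \<comment> \<open>Valid at the ends too: the s-direction is open there, so X is a genuine
    velocity, while the t-velocity is replaced by the derivative of \<open>f\<close>.\<close>
  have B: "H (t, 0) = g (\<gamma> t) (X t) (chart_field A d (d_t f (t, 0)) (\<gamma> t))" if "t \<in> {p..q}" for t
  proof -
    have "((\<lambda>s. f (t, s)) has_vector_derivative d_s f (t, 0)) (at 0)"
      by (rule has_vector_derivative_slice2[OF smooth_on_has_derivative[OF V fV(1)]])
         (use in1 zI that in auto)
    then have "X t = chart_field A d (d_s f (t, 0)) (\<gamma> t)"
      unfolding X[OF that, symmetric] \<gamma>[OF that, symmetric]
      by (rule velocity_chart[OF d, of "{-\<delta><..<\<delta>}", rotated -1]) (use that F \<delta> in auto)
    then show ?thesis
      using chart_metric_coord[OF d, of "\<gamma> t"] F[OF that, of 0] \<gamma>[OF that] \<delta>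
      unfolding H_def pairing_def by simp
  qed
  \<comment> \<open>Continues the coordinate expression of \<gamma> past p and q, so that its
    derivatives there give the one-sided limits.\<close>
  define \<kappa> where "\<kappa> = (\<lambda>t. f (t, 0))"
  define K where "K = {t. (t, 0) \<in> V}"
  have K: "open K" unfolding K_def by (rule open_slice1[OF V])
  have sm\<kappa>: "smooth_on K \<kappa>"
  proof -
    have "smooth_on K (f \<circ> (\<lambda>t. (t, 0)))"
      by (rule smooth_on_compose[OF K V fV(1) smooth_on_bounded_linear])
         (auto simp: K_def intro!: bounded_linear_Pair bounded_linear_ident bounded_linear_zero)
    then show ?thesis by (simp add: \<kappa>_def o_def)
  qed
  have \<kappa>': "frechet_derivative \<kappa> (at t) 1 = d_t f (t, 0)" if "t \<in> K" for t
  proof -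
    have "(\<kappa> has_vector_derivative d_t f (t, 0)) (at t)"
      unfolding \<kappa>_def
      by (rule has_vector_derivative_slice1[OF smooth_on_has_derivative[OF V fV(1)]])
         (use that K_def in auto)
    from frechet_derivative_at[OF this[unfolded has_vector_derivative_def], symmetric]
    show ?thesis by simp
  qed
  have pqK: "p \<in> K" "q \<in> K" using inV pq \<delta> by (auto simp: K_def)
  have "velocity_left A \<gamma> q = chart_field A d (frechet_derivative \<kappa> (at q) 1) (\<gamma> q)"
    \<comment> \<open>The cut at p keeps every u \<le> q of the set inside [p, q], where \<kappa>
      represents \<gamma>; the cut at q below does the same on the other side.\<close>
    by (rule velocity_left_chart[OF d, of "K \<inter> {p<..}"])
       (use pq K pqK smooth_on_subset[OF sm\<kappa>] F[of _ 0] \<gamma> \<delta> in \<open>auto simp: \<kappa>_def\<close>)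
  moreover have "velocity_right A \<gamma> p = chart_field A d (frechet_derivative \<kappa> (at p) 1) (\<gamma> p)"
    by (rule velocity_right_chart[OF d, of "K \<inter> {..<q}"])
       (use pq K pqK smooth_on_subset[OF sm\<kappa>] F[of _ 0] \<gamma> \<delta> in \<open>auto simp: \<kappa>_def\<close>)
  ultimately have B': "g (\<gamma> q) (X q) (velocity_left A \<gamma> q) - g (\<gamma> p) (X p) (velocity_right A \<gamma> p) =
      H (q, 0) - H (p, 0)"
    using B[of p] B[of q] pq \<kappa>'[OF pqK(1)] \<kappa>'[OF pqK(2)] by simp
  show ?thesis
    unfolding first_variation_def B' integral_unique[OF int_I]
    using deriv_speed has_integral_integrable[OF int_I] has_integral_integrable[OF int_speed] \<eta>(1)
    by (auto simp: I_def abs_less_iff intro!: exI[of _ \<eta>])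
qed

end

text \<open>The radius depends on \<open>x\<close> only, not on p and q, as a bisection argument
  requires. Here m and n bound a piece on which the speed of \<gamma> is known.\<close>

lemma (in metric_connection) first_variation_local:
  assumes F: "smooth_map_into A ({u..v} \<times> {-\<epsilon><..<\<epsilon>}) (\<lambda>(t, s). F s t)"
    and \<epsilon>: "\<epsilon> > 0" and r: "r > 0" and x: "x \<in> {u..v}"
    and \<gamma>: "\<And>t. t \<in> {u..v} \<Longrightarrow> F 0 t = \<gamma> t"
    and X: "\<And>t. t \<in> {u..v} \<Longrightarrow> velocity A (\<lambda>s. F s t) 0 = X t"
    and speed: "\<And>t. t \<in> {m<..<n} \<Longrightarrow> tangent_norm g (\<gamma> t) (velocity A \<gamma> t) = r"
  shows "\<exists>e>0. \<forall>p q. p < q \<and> x - e < p \<and> q < x + e \<and> {p..q} \<subseteq> {u..v} \<and> {p..q} \<subseteq> {m..n} \<longrightarrow>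
    first_variation r F \<gamma> X p q
      (g (\<gamma> q) (X q) (velocity_left A \<gamma> q) - g (\<gamma> p) (X p) (velocity_right A \<gamma> p))"
proof -
  let ?S = "{u..v} \<times> {-\<epsilon><..<\<epsilon>}"
  let ?F = "\<lambda>(t, s). F s t"
  have "(x, 0) \<in> ?S" using x \<epsilon> by simp
  then obtain d V where d: "d \<in> A" and V: "open V" "(x, 0) \<in> V" "?F ` (V \<inter> ?S) \<subseteq> cdom d"
    and sm: "smooth_on (V \<inter> ?S) (coord d \<circ> ?F)"
    using F unfolding smooth_map_into_def by metis
  obtain U f where U: "open U" "V \<inter> ?S \<subseteq> U" "\<forall>k. Ck_on k U f"
    and f: "\<forall>z\<in>V \<inter> ?S. f z = (coord d \<circ> ?F) z"
    using sm unfolding smooth_on_def by auto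
  have smf: "smooth_on U f" using U smooth_on_open_iff by blast
  obtain V1 V2 where V12: "open V1" "open V2" "x \<in> V1" "0 \<in> V2" "V1 \<times> V2 \<subseteq> V"
    using V unfolding open_prod_def by fastforce
  obtain e where e: "e > 0" "ball x e \<subseteq> V1" using V12 openE by blast
  obtain e' where e': "e' > 0" "ball 0 e' \<subseteq> V2" using V12 openE by blast
  \<comment> \<open>\<open>e'\<close> keeps (t, s) in the chart neighbourhood, \<epsilon> in the
    domain of the variation.\<close>
  define \<delta> where "\<delta> = min e' \<epsilon>"
  have \<delta>: "\<delta> > 0" using e' \<epsilon> by (simp add: \<delta>_def)
  show ?thesis
  proof (intro exI[of _ e] conjI allI impI)
    show "e > 0" by (fact e(1))
    fix p q
    assume pq: "p < q \<and> x - e < p \<and> q < x + e \<and> {p..q} \<subseteq> {u..v} \<and> {p..q} \<subseteq> {m..n}"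
    have inV: "(t, s) \<in> V \<inter> ?S" if "t \<in> {p..q}" "\<bar>s\<bar> < \<delta>" for t s
    proof -
      have "t \<in> ball x e" using that pq by (auto simp: dist_real_def)
      moreover have "s \<in> ball 0 e'" using that by (auto simp: \<delta>_def)
      ultimately have "(t, s) \<in> V" using e(2) e'(2) V12(5) by blast
      moreover have "t \<in> {u..v}" using that pq by blast
      ultimately show ?thesis using that by (auto simp: \<delta>_def)
    qed
    show "first_variation r F \<gamma> X p q
      (g (\<gamma> q) (X q) (velocity_left A \<gamma> q) - g (\<gamma> p) (X p) (velocity_right A \<gamma> p))"
    proof (rule first_variation_in_chart[OF d _ \<delta> r U(1) smf])
      show "{p..q} \<times> {-\<delta><..<\<delta>} \<subseteq> U"
      proof clarify
        fix t s assume "t \<in> {p..q}" "s \<in> {-\<delta><..<\<delta>}"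
        then have "(t, s) \<in> V \<inter> ?S" by (intro inV) auto
        then show "(t, s) \<in> U" using U(2) by blast
      qed
      show "F s t \<in> cdom d \<and> coord d (F s t) = f (t, s)" if "t \<in> {p..q}" "\<bar>s\<bar> < \<delta>" for t s
        using inV[OF that] V(3) f by fastforce
      show "tangent_norm g (\<gamma> t) (velocity A \<gamma> t) = r" if "t \<in> {p<..<q}" for t
      proof -
        have "p \<in> {m..n}" "q \<in> {m..n}" using pq by auto
        then show ?thesis using that by (intro speed) auto
      qed
    qed (use pq \<gamma> X in auto)
  qed
qed

section \<open>Patching along the curve\<close>

lemma is_partition_mono:
  assumes "is_partition a b k t" "i \<le> j" "j \<le> k"
  shows "t i \<le> t j"
  using assms(2,3)
proof (induction j rule: dec_induct)
  case (step j)
  then show ?case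
    using assms(1) unfolding is_partition_def by (metis Suc_leD Suc_le_lessD less_imp_le order_trans)
qed simp

lemma is_partition_strict_mono:
  assumes "is_partition a b k t" "i < j" "j \<le> k"
  shows "t i < t j"
  using is_partition_mono[OF assms(1), of "Suc i" j] assms unfolding is_partition_def
  by (metis Suc_leI less_le_trans order_less_le_trans)

text \<open>The strict inequality on the right leaves room for an interval that starts at
  \<open>x\<close>, even if \<open>x\<close> is a break point.\<close>

lemma is_partition_segment_right:
  assumes "is_partition a b k t" "a \<le> x" "x < b"
  obtains j where "j < k" "t j \<le> x" "x < t (Suc j)"
proof -
  have 0: "t 0 \<le> x" "x < t k" using assms by (auto simp: is_partition_def)
  define j where "j = (LEAST i. x < t (Suc i))"
  have k: "k > 0" using 0 by (metis gr0I leD)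
  then have ex: "x < t (Suc (k - 1))" using 0 by simp
  then have 1: "x < t (Suc j)" unfolding j_def by (rule LeastI)
  have 2: "j \<le> k - 1" unfolding j_def using ex by (rule Least_le)
  have "t j \<le> x"
  proof (cases j)
    case (Suc i)
    then show ?thesis using not_less_Least[of i "\<lambda>i. x < t (Suc i)"] by (simp add: j_def)
  qed (use 0 in simp)
  then show ?thesis using that[of j] 1 2 k by simp
qed

lemma is_partition_segment_left:
  assumes "is_partition a b k t" "a < x" "x \<le> b"
  obtains j where "j < k" "t j < x" "x \<le> t (Suc j)"
proof -
  have 0: "t 0 < x" "x \<le> t k" using assms by (auto simp: is_partition_def)
  define j where "j = (LEAST i. x \<le> t (Suc i))"
  have k: "k > 0" using 0 by (metis gr0I leD)
  then have ex: "x \<le> t (Suc (k - 1))" using 0 by simp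
  then have 1: "x \<le> t (Suc j)" unfolding j_def by (rule LeastI)
  have 2: "j \<le> k - 1" unfolding j_def using ex by (rule Least_le)
  have "t j < x"
  proof (cases j)
    case (Suc i)
    then show ?thesis using not_less_Least[of i "\<lambda>i. x \<le> t (Suc i)"] by (simp add: j_def)
  qed (use 0 in simp)
  then show ?thesis using that[of j] 1 2 k by simp
qed

lemma is_partition_avoids:
  assumes "is_partition a b k t" "j < k" "i \<le> k"
  shows "t i \<notin> {t j<..<t (Suc j)}"
proof (cases "i \<le> j")
  case True
  then show ?thesis using is_partition_mono[OF assms(1) True] assms by auto
next
  case False
  then show ?thesis using is_partition_mono[OF assms(1), of "Suc j" i] assms by auto
qed

lemma is_partition_range:
  assumes "is_partition a b k t" "i \<le> k"
  shows "t i \<in> {a..b}"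
  using is_partition_mono[OF assms(1), of 0 i] is_partition_mono[OF assms(1), of i k] assms
  by (auto simp: is_partition_def)

theorem theorem10:
  fixes A :: "('m::{t2_space,second_countable_topology}, 'k::finite) chart set"
    and n :: nat
    and T10 :: "'m \<Rightarrow> (complex ^ 'k) set"
    and \<theta> :: "'m \<Rightarrow> real ^ 'k \<Rightarrow> real"
    and T :: "'m \<Rightarrow> real ^ 'k"
    and J :: "'m \<Rightarrow> real ^ 'k \<Rightarrow> real ^ 'k"
    and g :: "'m \<Rightarrow> real ^ 'k \<Rightarrow> real ^ 'k \<Rightarrow> real"
    and N :: "('m, 'k) connection"
    and a b r \<epsilon> :: real
    and y z :: 'm
    and \<gamma> :: "real \<Rightarrow> 'm"
    and X :: "real \<Rightarrow> real ^ 'k"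
    and h :: nat
    and c :: "nat \<Rightarrow> real"
    and F :: "real \<Rightarrow> real \<Rightarrow> 'm"
  assumes "smooth_atlas A" and "orientable A" and "CARD('k) = 2 * n + 1"
    and "cr_structure A n T10"
    and "contact_form A T10 \<theta>"
    and "characteristic_field A \<theta> T"
    and "cr_complex_structure T10 T J"
    and "\<And>p. positive_definite_on (levi T10 p) (G_form A \<theta> J p)"
    and "webster_metric A T10 \<theta> T J g"
    and "tanaka_webster A T10 \<theta> T J g N"
    and "a < b"
    and "\<gamma> \<in> curve_space A g a b y z"
    and "X \<in> curve_space_tangent A a b \<gamma>"
    and "is_partition a b (Suc h) c"
    and "\<And>j. j \<le> h \<Longrightarrow> smooth_map_into A {c j..c (Suc j)} \<gamma>"
    and "r > 0"
    and "\<And>j t. j \<le> h \<Longrightarrow> t \<in> {c j<..<c (Suc j)} \<Longrightarrow> tangent_norm g (\<gamma> t) (velocity A \<gamma> t) = r"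
    and "variation A g a b y z \<gamma> X \<epsilon> F"
  shows "((\<lambda>s. curve_length A g a b (F s)) has_real_derivative
      1 / r * ((\<Sum>j=1..h. g (\<gamma> (c j)) (X (c j)) (velocity_left A \<gamma> (c j) - velocity_right A \<gamma> (c j)))
        - integral {a..b} (\<lambda>t. g (\<gamma> t) (X t) (cov_deriv_along A N \<gamma> (velocity A \<gamma>) t)
            - g (\<gamma> t) (torsion A N (\<gamma> t) (X t) (velocity A \<gamma> t)) (velocity A \<gamma> t)))) (at 0)"
proof -
  interpret metric_connection A g N
  proof
    show "smooth_atlas A" by fact
    show "riemannian_metric A g" using assms(9) by (simp add: webster_metric_def)
    show "dir_deriv A p v (\<lambda>q. g q (Y q) (Z q)) = g p (N p v Y) (Z p) + g p (Y p) (N p v Z)"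
      if "open U" "smooth_vf A U Y" "smooth_vf A U Z" "p \<in> U" for U Y Z p v
    proof -
      have "\<forall>U Y Z. open U \<and> smooth_vf A U Y \<and> smooth_vf A U Z \<longrightarrow>
        (\<forall>p\<in>U. \<forall>v. dir_deriv A p v (\<lambda>q. g q (Y q) (Z q)) = g p (N p v Y) (Z p) + g p (Y p) (N p v Z))"
        using assms(10) unfolding tanaka_webster_def by (elim conjE)
      then show ?thesis using that by blast
    qed
  qed
  note part = assms(14) and r = assms(16)
  have \<epsilon>: "\<epsilon> > 0" and F0: "\<And>t. t \<in> {a..b} \<Longrightarrow> F 0 t = \<gamma> t"
    and X: "\<And>t. t \<in> {a..b} \<Longrightarrow> velocity A (\<lambda>s. F s t) 0 = X t"
    using assms(18) by (auto simp: variation_def)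
  obtain k \<tau> where \<tau>: "is_partition a b k \<tau>"
    and F: "\<And>i. i < k \<Longrightarrow> smooth_map_into A ({\<tau> i..\<tau> (Suc i)} \<times> {-\<epsilon><..<\<epsilon>}) (\<lambda>(t, s). F s t)"
    using assms(18) unfolding variation_def by auto
  define R where "R = (\<lambda>t. g (\<gamma> t) (X t) (velocity_right A \<gamma> t))"
  define L where "L = (\<lambda>t. g (\<gamma> t) (X t) (velocity_left A \<gamma> t))"
  define C where "C = c ` {1..h}"
  define B where "B = (\<lambda>p q. L q - R p + (\<Sum>t\<in>C \<inter> {p<..<q}. L t - R t))"
  \<comment> \<open>The rule \<open>Bolzano\<close> also asks for degenerate intervals and for those
    reaching beyond [a, b]; the guard makes \<open>P\<close> vacuous on them.\<close>
  define P where "P = (\<lambda>p q. a \<le> p \<and> p < q \<and> q \<le> b \<longrightarrow> first_variation r F \<gamma> X p q (B p q))"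
  have finC: "finite (C \<inter> S)" for S by (simp add: C_def)
  have no_jump: "L t = R t" if t: "t \<notin> C" "a < t" "t < b" for t
  proof -
    obtain j where j: "j < Suc h" "c j \<le> t" "t < c (Suc j)"
      using is_partition_segment_right[OF part] t by (metis less_imp_le)
    \<comment> \<open>Otherwise t would be a break point with index at least 1, because t > a, and
      so belong to \<open>C\<close>.\<close>
    have "c j \<noteq> t"
    proof
      assume "c j = t"
      moreover have "c 0 = a" using part by (simp add: is_partition_def)
      ultimately have "j \<noteq> 0" using t(2) by (metis less_irrefl)
      then show False using \<open>c j = t\<close> t(1) j(1) by (auto simp: C_def)
    qed
    then have "velocity_left A \<gamma> t = velocity_right A \<gamma> t"
      using velocity_left_eq_right[OF assms(15)[of j]] j by simp
    then show ?thesis by (simp add: L_def R_def)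
  qed
  have trans: "P p q" if "P p m" "P m q" "p \<le> m" "m \<le> q" for p m q
  proof (cases "p = m \<or> m = q")
    case False
    then have pmq: "p < m" "m < q" using that by auto
    have split: "C \<inter> {p<..<q} = (C \<inter> {p<..<m}) \<union> (C \<inter> {m}) \<union> (C \<inter> {m<..<q})"
      using pmq by auto
    have "(\<Sum>t\<in>C \<inter> {p<..<q}. L t - R t) = (\<Sum>t\<in>C \<inter> {p<..<m}. L t - R t) +
        (\<Sum>t\<in>C \<inter> {m}. L t - R t) + (\<Sum>t\<in>C \<inter> {m<..<q}. L t - R t)"
      unfolding split by (subst sum.union_disjoint sum.union_disjoint; auto simp: finC)+
    \<comment> \<open>Cutting at m adds L m - R m to the boundary terms. This is the jump counted by
      \<open>C\<close> if m is a break point, and zero otherwise.\<close>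
    moreover have "(\<Sum>t\<in>C \<inter> {m}. L t - R t) = L m - R m" if "a \<le> p" "q \<le> b"
      using no_jump[of m] that pmq by (cases "m \<in> C") auto
    ultimately have "B p q = B p m + B m q" if "a \<le> p" "q \<le> b"
      using that by (simp add: B_def)
    then show ?thesis
      using first_variation_combine[of r F \<gamma> X p m "B p m" q "B m q"] that pmq
      by (simp add: P_def)
  qed (use that in auto)
  have seg: "\<exists>e>0. \<forall>p q. p < q \<and> x - e < p \<and> q < x + e \<and> {p..q} \<subseteq> {\<tau> i..\<tau> (Suc i)} \<and>
      {p..q} \<subseteq> {c j..c (Suc j)} \<longrightarrow> P p q"
    if ij: "i < k" "j < Suc h" and x: "x \<in> {\<tau> i..\<tau> (Suc i)}" for i j x
  proof -
    have sub: "{\<tau> i..\<tau> (Suc i)} \<subseteq> {a..b}"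
      using is_partition_range[OF \<tau>, of i] is_partition_range[OF \<tau>, of "Suc i"] ij by auto
    have "\<exists>e>0. \<forall>p q. p < q \<and> x - e < p \<and> q < x + e \<and> {p..q} \<subseteq> {\<tau> i..\<tau> (Suc i)} \<and>
      {p..q} \<subseteq> {c j..c (Suc j)} \<longrightarrow>
      first_variation r F \<gamma> X p q
        (g (\<gamma> q) (X q) (velocity_left A \<gamma> q) - g (\<gamma> p) (X p) (velocity_right A \<gamma> p))"
      by (rule first_variation_local[OF F[OF ij(1)] \<epsilon> r x]) (use sub ij F0 X assms(17)[of j] in auto)
    then obtain e where e: "e > 0" "\<And>p q. p < q \<Longrightarrow> x - e < p \<Longrightarrow> q < x + e \<Longrightarrow>
      {p..q} \<subseteq> {\<tau> i..\<tau> (Suc i)} \<Longrightarrow> {p..q} \<subseteq> {c j..c (Suc j)} \<Longrightarrow>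
      first_variation r F \<gamma> X p q (L q - R p)"
      unfolding L_def R_def by blast
    \<comment> \<open>No break point lies inside a piece, so \<open>B\<close> reduces there to its
      two end terms.\<close>
    have "C \<inter> {p<..<q} = {}" if "{p..q} \<subseteq> {c j..c (Suc j)}" "p < q" for p q
    proof -
      have "p \<in> {c j..c (Suc j)}" "q \<in> {c j..c (Suc j)}" using that by auto
      then have "{p<..<q} \<subseteq> {c j<..<c (Suc j)}" by auto
      then show ?thesis using is_partition_avoids[OF part ij(2)] by (fastforce simp: C_def)
    qed
    then show ?thesis using e by (intro exI[of _ e]) (auto simp: P_def B_def)
  qed
  \<comment> \<open>\<open>x\<close> may be a break point of either partition, so an interval around
    it need not lie in one piece. Each half does, once it is shorter than the distance to the next
    break point of both partitions.\<close>
  have right: "\<exists>e>0. \<forall>q. q < x + e \<longrightarrow> P x q" if x: "a \<le> x" "x < b" for x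
  proof -
    obtain i where i: "i < k" "\<tau> i \<le> x" "x < \<tau> (Suc i)" using is_partition_segment_right[OF \<tau> x] .
    obtain j where j: "j < Suc h" "c j \<le> x" "x < c (Suc j)" using is_partition_segment_right[OF part x] .
    obtain e where e: "e > 0" "\<And>p q. p < q \<Longrightarrow> x - e < p \<Longrightarrow> q < x + e \<Longrightarrow>
      {p..q} \<subseteq> {\<tau> i..\<tau> (Suc i)} \<Longrightarrow> {p..q} \<subseteq> {c j..c (Suc j)} \<Longrightarrow> P p q"
      using seg[OF i(1) j(1), of x] i by auto
    show ?thesis
    proof (intro exI[of _ "min e (min (\<tau> (Suc i) - x) (c (Suc j) - x))"] conjI allI impI)
      fix q assume q: "q < x + min e (min (\<tau> (Suc i) - x) (c (Suc j) - x))"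
      show "P x q"
      proof (cases "x < q")
        case True
        then show ?thesis using q i j e(1) by (intro e(2)) auto
      qed (simp add: P_def)
    qed (use e i j in auto)
  qed
  have left: "\<exists>e>0. \<forall>p. x - e < p \<longrightarrow> P p x" if x: "a < x" "x \<le> b" for x
  proof -
    obtain i where i: "i < k" "\<tau> i < x" "x \<le> \<tau> (Suc i)" using is_partition_segment_left[OF \<tau> x] .
    obtain j where j: "j < Suc h" "c j < x" "x \<le> c (Suc j)" using is_partition_segment_left[OF part x] .
    obtain e where e: "e > 0" "\<And>p q. p < q \<Longrightarrow> x - e < p \<Longrightarrow> q < x + e \<Longrightarrow>
      {p..q} \<subseteq> {\<tau> i..\<tau> (Suc i)} \<Longrightarrow> {p..q} \<subseteq> {c j..c (Suc j)} \<Longrightarrow> P p q"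
      using seg[OF i(1) j(1), of x] i by auto
    show ?thesis
    proof (intro exI[of _ "min e (min (x - \<tau> i) (x - c j))"] conjI allI impI)
      fix p assume p: "x - min e (min (x - \<tau> i) (x - c j)) < p"
      show "P p x"
      proof (cases "p < x")
        case True
        then show ?thesis using p i j e(1) by (intro e(2)) auto
      qed (simp add: P_def)
    qed (use e i j in auto)
  qed
  have "P a b"
  proof (rule Bolzano)
    show "a \<le> b" using assms(11) by simp
    show "P p q" if "P p m" "P m q" "p \<le> m" "m \<le> q" for p m q
      using trans that by blast
    fix x assume x: "a \<le> x" "x \<le> b"
    obtain e where e: "e > 0" "\<And>q. q < x + e \<Longrightarrow> P x q"
    proof (cases "x < b")
      case True
      then show ?thesis using right[OF x(1)] that by blast
    \<comment> \<open>At x = b nothing inside [a, b] lies to the right, so \<open>P\<close> is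
      vacuous and any radius works.\<close>
    next
      case False
      then have "P x q" for q by (auto simp: P_def)
      then show ?thesis using that[of 1] by simp
    qed
    obtain e' where e': "e' > 0" "\<And>p. x - e' < p \<Longrightarrow> P p x"
    proof (cases "a < x")
      case True
      then show ?thesis using left[OF _ x(2)] that by blast
    next
      case False
      then have "P p x" for p by (auto simp: P_def)
      then show ?thesis using that[of 1] by simp
    qed
    have "P p q" if "p \<le> x" "x \<le> q" "q - p < min e e'" for p q
      by (rule trans[of p x q]) (use that e e' in auto)
    then show "\<exists>d>0. \<forall>p q. p \<le> x \<and> x \<le> q \<and> q - p < d \<longrightarrow> P p q"
      using e(1) e'(1) by (intro exI[of _ "min e e'"]) auto
  qed
  then have fv: "first_variation r F \<gamma> X a b (B a b)"
    using assms(11) by (simp add: P_def)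
  have X0: "X a = 0" "X b = 0"
    using assms(13) by (auto simp: curve_space_tangent_def)
  have c_in: "c j \<in> {a<..<b}" if "j \<in> {1..h}" for j
    using is_partition_strict_mono[OF part, of 0 j] is_partition_strict_mono[OF part, of j "Suc h"] that part
    by (auto simp: is_partition_def)
  \<comment> \<open>\<open>B\<close> sums over the set of break points, the theorem over their
    indices; distinctness of the points reconciles the two.\<close>
  have "inj_on c {1..h}"
    by (rule linorder_inj_onI) (use is_partition_strict_mono[OF part] in fastforce)+
  then have "(\<Sum>t\<in>C. L t - R t) = (\<Sum>j=1..h. L (c j) - R (c j))"
    unfolding C_def by (simp add: sum.reindex)
  moreover have "C \<inter> {a<..<b} = C" using c_in by (auto simp: C_def)
  \<comment> \<open>The outer boundary terms vanish because X is zero at both ends.\<close>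
  moreover have "L b = 0" "R a = 0"
    using X0 by (simp_all add: L_def R_def bilinear_lzero[OF bilinear_g])
  ultimately have "B a b = (\<Sum>j=1..h. g (\<gamma> (c j)) (X (c j)) (velocity_left A \<gamma> (c j) - velocity_right A \<gamma> (c j)))"
    by (simp add: B_def g_simps L_def R_def)
  with fv show ?thesis
    unfolding first_variation_def curve_length_def variation_integrand_def[abs_def] speed_def[abs_def]
    by simp
qed

end
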